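(* Fix $1\le i<j\le g$. Then \[ \mathbf{\Sigma}(i,j)=-2\big\langle(I-P)^{-1}f_i,f_j\big\rangle_\pi , \] and \[ \mathbf{\Sigma}(i,j)\ \ge\ \frac{\pi_E(e_i)\big(P(x_i,y_i)+P(y_i,x_i)\big)+\pi_E(e_j)\big(P(x_j,y_j)+P(y_j,x_j)\big)}{1-\gamma_{\min}}-\frac{\|f_i+f_j\|_\pi^2}{\delta}, \] \[ \mathbf{\Sigma}(i,j)\ \le\ \frac{\pi_E(e_i)\big(P(x_i,y_i)+P(y_i,x_i)\big)+\pi_E(e_j)\big(P(x_j,y_j)+P(y_j,x_j)\big)}{\delta}-\frac{\|f_i+f_j\|_\pi^2}{1-\gamma_{\min}}. \]
   Context: Setting: - $G$ is a finite connected simple graph. - $(X_t)$ is a Markov chain on $V(G)$ with transition matrix $P$, where $P(x,y)=0$ unless $x=y$ or $\{x,y\}$ is an edge. - The chain is irreducible, aperiodic, lazy ($P(x,x)\ge1/2$, so all eigenvalues of $P$ are nonnegative), and reversible with respect to its stationary distribution $\pi$. Edge-walk: - The edge-walk is $Y_t=(X_t,X_{t+1})$ on $\{(x,y):P(x,y)\ne0\}$. - Its stationary distribution is $\pi_E$. Accumulated homology and $\mathbf{\Sigma}$: - Fix a spanning tree of $G$ with complementary edges $e_1,\dots,e_g$, oriented as $e_i=(x_i,y_i)$; write $\pi_E(e_i)=\pi_E(x_i,y_i)$. - $H_1(\rho_X(t))\in\mathbb{Z}^g$ has $i$-th coordinate equal to the number of steps of $X_0,\dots,X_t$ from $x_i$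 to $y_i$ minus the number of steps from $y_i$ to $x_i$. - $\mathbf{\Sigma}$ is the $g\times g$ matrix such that $H_1(\rho_X(t))/\sqrt t\to\mathcal{N}(0,\mathbf{\Sigma})$ in distribution. Functions, norms and inverse: - $f_i:V(G)\to\mathbb{R}$ takes value $P(x_i,y_i)$ at $x_i$, $-P(y_i,x_i)$ at $y_i$, and $0$ elsewhere. - $\langle u,v\rangle_\pi=\sum_x\pi(x)u(x)v(x)$ and $\|u\|^2_\pi=\langle u,u\rangle_\pi$. - For $\pi$-mean-zero $h$, $(I-P)^{-1}h$ is a solution $u$ of $(I-P)u=h$ with $\pi$-mean zero. Spectral quantities: $\delta$ is the spectral gap of $P$, and $\gamma_{\min}$ is the smallest eigenvalue of $P$. *)

theory Defs
  imports "HOL-Probability.Probability"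
begin

section \<open>Simple graphs with vertex set a finite type\<close>

definition simple_graph :: "'v set set \<Rightarrow> bool" where
  "simple_graph E \<longleftrightarrow> (\<forall>e\<in>E. card e = 2)"

definition graph_connected :: "'v set set \<Rightarrow> bool" where
  "graph_connected E \<longleftrightarrow> (\<forall>u v. (u, v) \<in> {(x, y). {x, y} \<in> E}\<^sup>*)"

definition graph_cycle :: "'v set set \<Rightarrow> 'v list \<Rightarrow> bool" where
  "graph_cycle E c \<longleftrightarrow> length c \<ge> 3 \<and> distinct c \<and>
     (\<forall>k < length c. {c ! k, c ! (Suc k mod length c)} \<in> E)"

definition spanning_tree :: "'v set set \<Rightarrow> 'v set set \<Rightarrow> bool" where
  "spanning_tree E T \<longleftrightarrow> T \<subseteq> E \<and> graph_connected T \<and> (\<nexists>c. graph_cycle T c)"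

section \<open>Transition matrices\<close>

definition stochastic :: "real^'v^'v \<Rightarrow> bool" where
  "stochastic P \<longleftrightarrow> (\<forall>x y. P $ x $ y \<ge> 0) \<and> (\<forall>x. (\<Sum>y\<in>UNIV. P $ x $ y) = 1)"

definition mat_pow :: "real^'v^'v \<Rightarrow> nat \<Rightarrow> real^'v^'v" where
  "mat_pow P t = ((**) P ^^ t) (mat 1)"

definition irreducible_chain :: "real^'v^'v \<Rightarrow> bool" where
  "irreducible_chain P \<longleftrightarrow> (\<forall>x y. \<exists>t. mat_pow P t $ x $ y > 0)"

definition aperiodic_chain :: "real^'v^'v \<Rightarrow> bool" where
  "aperiodic_chain P \<longleftrightarrow> (\<forall>x. Gcd {t. t \<ge> 1 \<and> mat_pow P t $ x $ x > 0} = 1)"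

definition lazy_chain :: "real^'v^'v \<Rightarrow> bool" where
  "lazy_chain P \<longleftrightarrow> (\<forall>x. P $ x $ x \<ge> 1/2)"

definition stationary_dist :: "'s set \<Rightarrow> ('s \<Rightarrow> 's \<Rightarrow> real) \<Rightarrow> ('s \<Rightarrow> real) \<Rightarrow> bool" where
  "stationary_dist S K \<mu> \<longleftrightarrow> (\<forall>x\<in>S. \<mu> x \<ge> 0) \<and> (\<Sum>x\<in>S. \<mu> x) = 1 \<and>
     (\<forall>y\<in>S. (\<Sum>x\<in>S. \<mu> x * K x y) = \<mu> y)"

definition reversible :: "real^'v^'v \<Rightarrow> ('v \<Rightarrow> real) \<Rightarrow> bool" where
  "reversible P \<mu> \<longleftrightarrow> (\<forall>x y. \<mu> x * P $ x $ y = \<mu> y * P $ y $ x)"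

definition is_eigenvalue :: "real^'v^'v \<Rightarrow> real \<Rightarrow> bool" where
  "is_eigenvalue P k \<longleftrightarrow> (\<exists>v. v \<noteq> 0 \<and> P *v v = k *\<^sub>R v)"

text \<open>All eigenvalues of a reversible chain are real, and for an irreducible chain the eigenvalue
  1 is simple, so the maximum below is the second largest eigenvalue counted with multiplicity.\<close>

definition spectral_gap :: "real^'v^'v \<Rightarrow> real" where
  "spectral_gap P = 1 - Max {k. is_eigenvalue P k \<and> k \<noteq> 1}"

definition min_eigenvalue :: "real^'v^'v \<Rightarrow> real" where
  "min_eigenvalue P = Min {k. is_eigenvalue P k}"

text \<open>The initial distribution of the chain is arbitrary.\<close>

definition markov_chain :: "'w measure \<Rightarrow> (nat \<Rightarrow> 'w \<Rightarrow> 'v) \<Rightarrow> real^'v^'v \<Rightarrow> bool" where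
  "markov_chain M X P \<longleftrightarrow> prob_space M \<and> (\<forall>t. X t \<in> measurable M (count_space UNIV)) \<and>
     (\<forall>t h y. measure M {\<omega> \<in> space M. \<forall>s\<le>t. X s \<omega> = h s} \<noteq> 0 \<longrightarrow>
        cond_prob M (\<lambda>\<omega>. X (Suc t) \<omega> = y) (\<lambda>\<omega>. \<forall>s\<le>t. X s \<omega> = h s) = P $ h t $ y)"

section \<open>The edge-walk\<close>

text \<open>A stationary distribution of the edge-walk is constrained only on these states. If an edge
  carries no transition, reversibility makes both directions vanish, and the value assigned to that
  edge is always multiplied by \<open>0\<close> in the bounds.\<close>

definition edge_states :: "real^'v^'v \<Rightarrow> ('v \<times> 'v) set" where
  "edge_states P = {(x, y). P $ x $ y \<noteq> 0}"

definition edge_kernel :: "real^'v^'v \<Rightarrow> 'v \<times> 'v \<Rightarrow> 'v \<times> 'v \<Rightarrow> real" where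
  "edge_kernel P a b = (if fst b = snd a then P $ fst b $ snd b else 0)"

section \<open>Accumulated homology\<close>

definition homology_coord :: "'v \<times> 'v \<Rightarrow> (nat \<Rightarrow> 'v) \<Rightarrow> nat \<Rightarrow> int" where
  "homology_coord a x t =
     int (card {s. s < t \<and> x s = fst a \<and> x (Suc s) = snd a}) -
     int (card {s. s < t \<and> x s = snd a \<and> x (Suc s) = fst a})"

definition scaled_homology :: "('g \<Rightarrow> 'v \<times> 'v) \<Rightarrow> (nat \<Rightarrow> 'w \<Rightarrow> 'v) \<Rightarrow> nat \<Rightarrow> 'w \<Rightarrow> real^'g" where
  "scaled_homology e X t \<omega> = (\<chi> i. real_of_int (homology_coord (e i) (\<lambda>s. X s \<omega>) t) / sqrt (real t))"

section \<open>Multivariate central limit behaviour\<close>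

definition converges_in_distribution ::
    "(nat \<Rightarrow> 'a::topological_space measure) \<Rightarrow> 'a measure \<Rightarrow> bool" where
  "converges_in_distribution \<mu> N \<longleftrightarrow>
     (\<forall>f :: 'a \<Rightarrow> real. continuous_on UNIV f \<and> bounded (range f) \<longrightarrow>
        (\<lambda>t. integral\<^sup>L (\<mu> t) f) \<longlonglongrightarrow> integral\<^sup>L N f)"

definition normal_dist :: "real \<Rightarrow> real measure" where
  "normal_dist v =
     (if v = 0 then return borel 0 else density lborel (\<lambda>x. ennreal (normal_density 0 (sqrt v) x)))"

text \<open>A possibly degenerate centred Gaussian law, described by its one-dimensional projections.
  These see only the symmetric part of the matrix, so symmetry is required separately;
  positive semidefiniteness is needed because a negative \<open>v\<close> would give \<open>normal_dist v\<close> the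
  variance \<open>- v\<close>.\<close>

definition centered_gaussian :: "real^'g^'g \<Rightarrow> (real^'g) measure \<Rightarrow> bool" where
  "centered_gaussian S N \<longleftrightarrow> prob_space N \<and> sets N = sets borel \<and>
     transpose S = S \<and> (\<forall>u. u \<bullet> (S *v u) \<ge> 0) \<and>
     (\<forall>u. distr N borel (\<lambda>x. u \<bullet> x) = normal_dist (u \<bullet> (S *v u)))"

definition converges_to_gaussian :: "'w measure \<Rightarrow> (nat \<Rightarrow> 'w \<Rightarrow> real^'g) \<Rightarrow> real^'g^'g \<Rightarrow> bool" where
  "converges_to_gaussian M Z S \<longleftrightarrow>
     (\<exists>N. centered_gaussian S N \<and> converges_in_distribution (\<lambda>t. distr M borel (Z t)) N)"

section \<open>Functions on the vertex set\<close>

definition inner_pi :: "('v::finite \<Rightarrow> real) \<Rightarrow> real^'v \<Rightarrow> real^'v \<Rightarrow> real" where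
  "inner_pi \<mu> u v = (\<Sum>x\<in>UNIV. \<mu> x * u $ x * v $ x)"

definition norm_pi :: "('v::finite \<Rightarrow> real) \<Rightarrow> real^'v \<Rightarrow> real" where
  "norm_pi \<mu> u = sqrt (inner_pi \<mu> u u)"

definition edge_fun :: "real^'v^'v \<Rightarrow> 'v \<times> 'v \<Rightarrow> real^'v" where
  "edge_fun P a = (\<chi> v. if v = fst a then P $ fst a $ snd a
                        else if v = snd a then - P $ snd a $ fst a else 0)"

definition inv_I_minus :: "real^'v^'v \<Rightarrow> ('v::finite \<Rightarrow> real) \<Rightarrow> real^'v \<Rightarrow> real^'v" where
  "inv_I_minus P \<mu> h = (THE u. (mat 1 - P) *v u = h \<and> (\<Sum>x\<in>UNIV. \<mu> x * u $ x) = 0)"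

end

theory Submission
  imports Defs
begin

text \<open>For \<open>u \<in> \<real>\<^sup>g\<close> the projection \<open>u \<bullet> H\<^sub>1\<close> is the additive functional of the edge function
  \<open>\<phi>(x,y) = \<Sum>\<^sub>k u\<^sub>k (1[(x,y) = e\<^sub>k] - 1[(y,x) = e\<^sub>k])\<close>, whose drift is \<open>f = \<Sum>\<^sub>k u\<^sub>k f\<^sub>k\<close>. With
  \<open>g = (I - P)\<^sup>-\<^sup>1 f\<close> it differs by the bounded term \<open>g(X\<^sub>0) - g(X\<^sub>t)\<close> from a martingale with
  increments \<open>\<phi>(x,y) + g(y) - g(x)\<close>. Its fourth moment is \<open>O(t\<^sup>2)\<close>, so the second moments of the
  rescaled functional converge to that of the Gaussian limit, and \<open>u \<bullet> \<Sigma>u\<close> is the stationary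
  variance of an increment. As \<open>\<phi>\<close> is antisymmetric, reversibility turns this variance into
  \<open>\<Sum>\<^sub>x\<^sub>y \<pi>(x) P(x,y) \<phi>(x,y)\<^sup>2 - 2\<langle>g, f\<rangle>\<^sub>\<pi>\<close>. The first summand does not couple different
  edges, so polarization gives
  \<open>\<Sigma>(i,j) = \<langle>A f\<^sub>i, f\<^sub>i\<rangle> + \<langle>A f\<^sub>j, f\<^sub>j\<rangle> - \<langle>A (f\<^sub>i + f\<^sub>j), f\<^sub>i + f\<^sub>j\<rangle>\<close> with \<open>A = (I - P)\<^sup>-\<^sup>1\<close>, and the
  bounds follow from \<open>\<parallel>h\<parallel>\<^sup>2 / (1 - \<gamma>) \<le> \<langle>A h, h\<rangle> \<le> \<parallel>h\<parallel>\<^sup>2 / \<delta>\<close> for mean-zero \<open>h\<close>.\<close>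

section \<open>Weighted inner products\<close>

text \<open>A quadratic in t without negative values has nonpositive discriminant: for c > 0
  evaluate it at its minimizer t = -b/c; for c = 0 an affine function that is bounded below has
  slope zero.\<close>

lemma quadratic_nonneg_imp_sq_le:
  fixes a b c :: real
  assumes nonneg: "\<And>t. a + 2 * t * b + t\<^sup>2 * c \<ge> 0" and "c \<ge> 0"
  shows "b\<^sup>2 \<le> a * c"
proof (cases "c = 0")
  case True
  have "b = 0"
  proof (rule ccontr)
    assume "b \<noteq> 0"
    \<comment> \<open>For c = 0 this choice of t gives the value -1.\<close>
    with nonneg[of "- (a + 1) / (2 * b)"] True show False by (simp add: field_simps)
  qed
  with True show ?thesis by simp
next
  case False
  with \<open>c \<ge> 0\<close> have "c > 0" by simp
  have "0 \<le> (a + 2 * (- b / c) * b + (- b / c)\<^sup>2 * c) * c"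
    using nonneg[of "- b / c"] \<open>c > 0\<close> by simp
  also have "\<dots> = a * c - b\<^sup>2"
    using \<open>c > 0\<close> by (simp add: field_simps power2_eq_square)
  finally show ?thesis by simp
qed

lemma inner_pi_add_left: "inner_pi \<mu> (u + v) w = inner_pi \<mu> u w + inner_pi \<mu> v w"
  by (simp add: inner_pi_def algebra_simps sum.distrib)

lemma inner_pi_diff_left: "inner_pi \<mu> (u - v) w = inner_pi \<mu> u w - inner_pi \<mu> v w"
  by (simp add: inner_pi_def algebra_simps sum_subtractf)

lemma inner_pi_scaleR_left: "inner_pi \<mu> (c *\<^sub>R u) w = c * inner_pi \<mu> u w"
  by (simp add: inner_pi_def algebra_simps sum_distrib_left)

lemma inner_pi_commute: "inner_pi \<mu> u w = inner_pi \<mu> w u"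
  by (simp add: inner_pi_def mult_ac)

lemma inner_pi_add_right: "inner_pi \<mu> w (u + v) = inner_pi \<mu> w u + inner_pi \<mu> w v"
  by (metis inner_pi_add_left inner_pi_commute)

lemma inner_pi_diff_right: "inner_pi \<mu> w (u - v) = inner_pi \<mu> w u - inner_pi \<mu> w v"
  by (metis inner_pi_diff_left inner_pi_commute)

lemma inner_pi_scaleR_right: "inner_pi \<mu> w (c *\<^sub>R u) = c * inner_pi \<mu> w u"
  by (metis inner_pi_scaleR_left inner_pi_commute)

lemma inner_pi_zero [simp]: "inner_pi \<mu> 0 w = 0" "inner_pi \<mu> w 0 = 0"
  by (simp_all add: inner_pi_def)

lemmas inner_pi_simps = inner_pi_add_left inner_pi_add_right inner_pi_diff_left
  inner_pi_diff_right inner_pi_scaleR_left inner_pi_scaleR_right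

text \<open>The discriminant of t -> <L(u + t v), u + t v> is nonpositive. The form may be
  degenerate and is only controlled on \<open>W\<close>; later uses take L to be the identity, I -
  P, or r I - T with r the largest Rayleigh quotient of T on an invariant subspace.\<close>

lemma psd_form_Cauchy_Schwarz:
  fixes L :: "real^'v::finite \<Rightarrow> real^'v"
  assumes "linear L" and sym: "\<And>u v. u \<in> W \<Longrightarrow> v \<in> W \<Longrightarrow> inner_pi \<mu> (L u) v = inner_pi \<mu> u (L v)"
    and "subspace W" and nonneg: "\<And>u. u \<in> W \<Longrightarrow> inner_pi \<mu> (L u) u \<ge> 0"
    and "u \<in> W" "v \<in> W"
  shows "(inner_pi \<mu> (L u) v)\<^sup>2 \<le> inner_pi \<mu> (L u) u * inner_pi \<mu> (L v) v"
proof (rule quadratic_nonneg_imp_sq_le)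
  fix t :: real
  have "u + t *\<^sub>R v \<in> W"
    using assms by (simp add: subspace_add subspace_scale)
  from nonneg[OF this]
  show "0 \<le> inner_pi \<mu> (L u) u + 2 * t * inner_pi \<mu> (L u) v + t\<^sup>2 * inner_pi \<mu> (L v) v"
    using sym[OF \<open>v \<in> W\<close> \<open>u \<in> W\<close>] inner_pi_commute[of \<mu> v "L u"]
    by (simp add: linear_add[OF \<open>linear L\<close>] linear_scale[OF \<open>linear L\<close>] inner_pi_simps
        power2_eq_square algebra_simps)
qed (use assms in auto)

section \<open>Spectral theory of a reversible chain\<close>

locale reversible_chain =
  fixes P :: "real^'v::finite^'v" and \<pi> :: "'v \<Rightarrow> real"
  assumes stochastic: "stochastic P"
    and irreducible: "irreducible_chain P"
    and stationary: "stationary_dist UNIV (\<lambda>x y. P $ x $ y) \<pi>"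
    and reversible: "reversible P \<pi>"
begin

lemma P_nonneg: "P $ x $ y \<ge> 0"
  using stochastic by (simp add: stochastic_def)

lemma sum_P: "(\<Sum>y\<in>UNIV. P $ x $ y) = 1"
  using stochastic by (simp add: stochastic_def)

lemma balance: "\<pi> x * P $ x $ y = \<pi> y * P $ y $ x"
  using reversible by (simp add: reversible_def)

lemma \<pi>_nonneg: "\<pi> x \<ge> 0" and sum_\<pi>: "(\<Sum>x\<in>UNIV. \<pi> x) = 1"
  and \<pi>_stationary: "(\<Sum>x\<in>UNIV. \<pi> x * P $ x $ y) = \<pi> y"
  using stationary by (simp_all add: stationary_dist_def)

text \<open>Irreducibility is stated through matrix powers; here it becomes paths of positive
  transitions, so that properties can be propagated one step at a time. A positive entry of P^(t+1)
  has a positive summand, which provides the first step.\<close>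

lemma reachable: "(x, y) \<in> {(x, y). P $ x $ y > 0}\<^sup>*"
proof -
  have "(x, y) \<in> {(x, y). P $ x $ y > 0}\<^sup>*" if "mat_pow P t $ x $ y > 0" for t x
    using that
  proof (induction t arbitrary: x)
    case 0
    then show ?case by (auto simp: mat_pow_def mat_def split: if_splits)
  next
    case (Suc t)
    have "0 < (\<Sum>z\<in>UNIV. P $ x $ z * mat_pow P t $ z $ y)"
      using Suc.prems by (simp add: mat_pow_def matrix_matrix_mult_def)
    then obtain z where z: "0 < P $ x $ z * mat_pow P t $ z $ y"
      by (metis (no_types, lifting) sum_nonpos not_le)
    with P_nonneg[of x z] have "P $ x $ z > 0" "mat_pow P t $ z $ y > 0"
      by (auto simp: zero_less_mult_iff)
    with Suc.IH[of z] show ?case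
      by (auto intro: converse_rtrancl_into_rtrancl)
  qed
  then show ?thesis
    using irreducible unfolding irreducible_chain_def by blast
qed

text \<open>Some state has positive mass, and detailed balance carries positivity across every
  positive transition.\<close>

lemma \<pi>_pos: "\<pi> x > 0"
proof -
  obtain x0 where "\<pi> x0 > 0"
    using sum_\<pi> by (metis sum_nonpos not_le zero_less_one)
  from reachable[of x0 x] this show ?thesis
  proof (induction rule: rtrancl_induct)
    case (step y z)
    then have "0 < \<pi> y * P $ y $ z" by simp
    then show ?case
      using balance[of y z] \<pi>_nonneg[of z] by (metis less_eq_real_def mult_zero_left)
  qed
qed

lemma inner_pi_nonneg: "inner_pi \<pi> u u \<ge> 0"
  by (simp add: inner_pi_def sum_nonneg \<pi>_nonneg mult.assoc)

lemma inner_pi_eq_0: "inner_pi \<pi> u u = 0 \<longleftrightarrow> u = 0"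
proof
  assume "inner_pi \<pi> u u = 0"
  then have "\<forall>x\<in>UNIV. \<pi> x * u $ x * u $ x = 0"
    unfolding inner_pi_def
    by (subst (asm) sum_nonneg_eq_0_iff) (simp_all add: \<pi>_nonneg mult.assoc)
  then show "u = 0" using \<pi>_pos by (simp add: vec_eq_iff) (metis less_irrefl)
qed simp

lemma inner_pi_pos: "u \<noteq> 0 \<Longrightarrow> inner_pi \<pi> u u > 0"
  using inner_pi_nonneg[of u] inner_pi_eq_0[of u] by linarith

lemma P_self_adjoint: "inner_pi \<pi> (P *v u) v = inner_pi \<pi> u (P *v v)"
proof -
  have "inner_pi \<pi> (P *v u) v = (\<Sum>x\<in>UNIV. \<Sum>y\<in>UNIV. \<pi> x * P $ x $ y * u $ y * v $ x)"
    by (simp add: inner_pi_def matrix_vector_mult_def sum_distrib_left sum_distrib_right mult_ac)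
  also have "\<dots> = (\<Sum>y\<in>UNIV. \<Sum>x\<in>UNIV. \<pi> y * P $ y $ x * u $ y * v $ x)"
    by (subst sum.swap) (simp add: balance)
  also have "\<dots> = inner_pi \<pi> u (P *v v)"
    by (simp add: inner_pi_def matrix_vector_mult_def sum_distrib_left sum_distrib_right mult_ac)
  finally show ?thesis .
qed

lemma P_one: "P *v 1 = 1"
  by (simp add: vec_eq_iff matrix_vector_mult_def sum_P)

lemma inner_pi_one: "inner_pi \<pi> 1 u = (\<Sum>x\<in>UNIV. \<pi> x * u $ x)" "inner_pi \<pi> 1 1 = 1"
  by (simp_all add: inner_pi_def sum_\<pi>)

lemma inner_pi_one_P: "inner_pi \<pi> 1 (P *v u) = inner_pi \<pi> 1 u"
  by (metis P_self_adjoint P_one)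

section \<open>The Dirichlet form and the Poisson equation\<close>

text \<open>Expanding the square gives <u,u> + <u,u> - 2 <P u,u>: the x-part uses that rows sum to
  1, the y-part reduces to it by detailed balance. The formula exhibits I - P as positive
  semidefinite.\<close>

lemma dirichlet_form:
  "inner_pi \<pi> (u - P *v u) u = (\<Sum>x\<in>UNIV. \<Sum>y\<in>UNIV. \<pi> x * P $ x $ y * (u $ x - u $ y)\<^sup>2) / 2"
proof -
  have a: "(\<Sum>x\<in>UNIV. \<Sum>y\<in>UNIV. \<pi> x * P $ x $ y * (u $ x)\<^sup>2) = inner_pi \<pi> u u"
    by (simp add: inner_pi_def power2_eq_square sum_P mult_ac
        flip: sum_distrib_left sum_distrib_right)
  have b: "(\<Sum>x\<in>UNIV. \<Sum>y\<in>UNIV. \<pi> x * P $ x $ y * (u $ y)\<^sup>2) = inner_pi \<pi> u u"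
    by (subst a[symmetric], subst sum.swap) (simp add: balance)
  have c: "(\<Sum>x\<in>UNIV. \<Sum>y\<in>UNIV. \<pi> x * P $ x $ y * (u $ x * u $ y)) = inner_pi \<pi> (P *v u) u"
    by (simp add: inner_pi_def matrix_vector_mult_def sum_distrib_left sum_distrib_right mult_ac)
  have "(\<Sum>x\<in>UNIV. \<Sum>y\<in>UNIV. \<pi> x * P $ x $ y * (u $ x - u $ y)\<^sup>2) =
      (\<Sum>x\<in>UNIV. \<Sum>y\<in>UNIV. \<pi> x * P $ x $ y * (u $ x)\<^sup>2) + (\<Sum>x\<in>UNIV. \<Sum>y\<in>UNIV. \<pi> x * P $ x $ y * (u $ y)\<^sup>2)
      - 2 * (\<Sum>x\<in>UNIV. \<Sum>y\<in>UNIV. \<pi> x * P $ x $ y * (u $ x * u $ y))"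
    unfolding sum_distrib_left sum.distrib[symmetric] sum_subtractf[symmetric]
    by (simp add: power2_diff algebra_simps)
  then show ?thesis by (simp add: a b c inner_pi_simps)
qed

lemma dirichlet_nonneg: "inner_pi \<pi> (u - P *v u) u \<ge> 0"
  unfolding dirichlet_form by (intro divide_nonneg_pos sum_nonneg) (simp_all add: \<pi>_nonneg P_nonneg)

text \<open>All summands of the Dirichlet form are nonnegative, so each vanishes and u agrees at the
  two ends of every positive transition; reachability spreads the equality to all pairs.\<close>

lemma dirichlet_eq_0_imp_const:
  assumes "inner_pi \<pi> (u - P *v u) u = 0"
  shows "u $ x = u $ y"
proof -
  have *: "u $ x = u $ y" if "P $ x $ y > 0" for x y
  proof -
    have "(\<Sum>y\<in>UNIV. \<pi> x * P $ x $ y * (u $ x - u $ y)\<^sup>2) = 0"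
      by (rule sum_nonneg_0[of UNIV "\<lambda>x. \<Sum>y\<in>UNIV. \<pi> x * P $ x $ y * (u $ x - u $ y)\<^sup>2"])
        (use assms in \<open>simp_all add: dirichlet_form sum_nonneg \<pi>_nonneg P_nonneg\<close>)
    then have "\<pi> x * P $ x $ y * (u $ x - u $ y)\<^sup>2 = 0"
      by (rule sum_nonneg_0[rotated 2]) (simp_all add: \<pi>_nonneg P_nonneg)
    with that \<pi>_pos[of x] show ?thesis by auto
  qed
  show ?thesis
    using reachable[of x y] by (induction rule: rtrancl_induct) (auto dest: *)
qed

lemma harmonic_imp_const: "P *v u = u \<Longrightarrow> u $ x = u $ y"
  by (rule dirichlet_eq_0_imp_const) simp

lemma harmonic_mean_0_imp_0:
  assumes "P *v u = u" "inner_pi \<pi> 1 u = 0"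
  shows "u = 0"
proof -
  fix x0
  have "u $ x = u $ x0" for x
    using harmonic_imp_const[OF assms(1)] .
  then have c: "u = u $ x0 *\<^sub>R 1" by (simp add: vec_eq_iff)
  have "inner_pi \<pi> 1 u = u $ x0"
    by (subst c) (simp only: inner_pi_scaleR_right inner_pi_one(2) mult_1_right)
  with assms(2) c show ?thesis by simp
qed

lemma poisson_solvable:
  assumes "inner_pi \<pi> 1 h = 0"
  shows "\<exists>u. u - P *v u = h \<and> inner_pi \<pi> 1 u = 0"
proof -
  \<comment> \<open>adding the projection onto the constants makes \<open>I - P\<close> invertible\<close>
  define L :: "real^'v \<Rightarrow> real^'v" where "L u = u - P *v u + inner_pi \<pi> 1 u *\<^sub>R 1" for u
  have lin: "linear L"
    by (rule linearI) (simp_all add: L_def matrix_vector_right_distrib inner_pi_simps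
        algebra_simps matrix_vector_mult_scaleR)
  \<comment> \<open>Since \<open>L\<close> preserves the mean, a mean-zero right-hand side forces a
    mean-zero solution, and then the added projection term disappears.\<close>
  have mean: "inner_pi \<pi> 1 (L u) = inner_pi \<pi> 1 u" for u
    by (simp add: L_def inner_pi_simps inner_pi_one_P inner_pi_one(2))
  have "u = 0" if "L u = 0" for u
  proof -
    have 0: "inner_pi \<pi> 1 u = 0" using mean[of u] that by simp
    with that have "P *v u = u" by (simp add: L_def)
    with 0 show ?thesis by (simp add: harmonic_mean_0_imp_0)
  qed
  then have "surj L"
    using lin by (simp add: linear_injective_imp_surjective linear_injective_0)
  then obtain u where "h = L u" by (auto simp: surj_def)
  with assms mean[of u] show ?thesis by (intro exI[of _ u]) (simp add: L_def)
qed

text \<open>This licenses the definite description in \<open>inv_I_minus\<close>: existence is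
  \<open>poisson_solvable\<close>, and the difference of two solutions is harmonic with mean zero,
  hence 0.\<close>

lemma inv_I_minus_props:
  assumes "inner_pi \<pi> 1 h = 0"
  shows "inv_I_minus P \<pi> h - P *v inv_I_minus P \<pi> h = h" "inner_pi \<pi> 1 (inv_I_minus P \<pi> h) = 0"
proof -
  have "\<exists>!u. (mat 1 - P) *v u = h \<and> (\<Sum>x\<in>UNIV. \<pi> x * u $ x) = 0"
  proof (rule ex_ex1I)
    show "\<exists>u. (mat 1 - P) *v u = h \<and> (\<Sum>x\<in>UNIV. \<pi> x * u $ x) = 0"
      using poisson_solvable[OF assms] by (simp add: matrix_vector_mult_diff_rdistrib inner_pi_one)
  next
    fix u v
    assume u: "(mat 1 - P) *v u = h \<and> (\<Sum>x\<in>UNIV. \<pi> x * u $ x) = 0"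
      and v: "(mat 1 - P) *v v = h \<and> (\<Sum>x\<in>UNIV. \<pi> x * v $ x) = 0"
    then have "u - P *v u = v - P *v v"
      by (simp add: matrix_vector_mult_diff_rdistrib)
    then have "P *v (u - v) = u - v"
      by (simp add: matrix_vector_mult_diff_distrib algebra_simps)
    moreover have "inner_pi \<pi> 1 (u - v) = 0"
      using u v by (simp add: inner_pi_diff_right inner_pi_one)
    ultimately show "u = v" using harmonic_mean_0_imp_0 by fastforce
  qed
  from theI'[OF this] show "inv_I_minus P \<pi> h - P *v inv_I_minus P \<pi> h = h" "inner_pi \<pi> 1 (inv_I_minus P \<pi> h) = 0"
    by (simp_all add: inv_I_minus_def matrix_vector_mult_diff_rdistrib inner_pi_one)
qed

section \<open>Rayleigh quotients, extreme eigenvalues and bounds for the inverse of I - P\<close>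

text \<open>The Rayleigh quotient is invariant under scaling, so it attains its maximum on the
  compact Euclidean unit sphere of \<open>W\<close>, and a maximizer is an eigenvector. Applied to P
  on mean-zero functions and to -P on the whole space, this replaces a full diagonalization.\<close>

lemma rayleigh_max:
  assumes "subspace W" "W \<noteq> {0}" "linear T" and inv: "\<And>u. u \<in> W \<Longrightarrow> T u \<in> W"
    and sym: "\<And>u v. inner_pi \<pi> (T u) v = inner_pi \<pi> u (T v)"
  obtains m v where "v \<in> W" "v \<noteq> 0" "T v = m *\<^sub>R v"
    "\<And>u. u \<in> W \<Longrightarrow> inner_pi \<pi> (T u) u \<le> m * inner_pi \<pi> u u"
proof -
  define r where "r u = inner_pi \<pi> (T u) u / inner_pi \<pi> u u" for u
  have "compact (sphere 0 1 \<inter> W)"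
    using closed_subspace[OF \<open>subspace W\<close>] by (intro compact_Int_closed) auto
  moreover have unit: "(1 / norm u) *\<^sub>R u \<in> sphere 0 1 \<inter> W" if "u \<in> W" "u \<noteq> 0" for u
    using that \<open>subspace W\<close> by (simp add: subspace_scale)
  then have "sphere 0 1 \<inter> W \<noteq> {}"
    using \<open>W \<noteq> {0}\<close> subspace_0[OF \<open>subspace W\<close>] by blast
  moreover have "continuous_on (sphere 0 1 \<inter> W) r"
  proof -
    have "inner_pi \<pi> u u \<noteq> 0" if "u \<in> sphere 0 1 \<inter> W" for u
      using that inner_pi_eq_0[of u] by auto
    moreover have "continuous_on S T" for S
      using \<open>linear T\<close> by (rule linear_continuous_on[OF linear_conv_bounded_linear[THEN iffD1]])
    ultimately show ?thesis
      unfolding r_def inner_pi_def by (intro continuous_intros) auto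
  qed
  ultimately obtain v where v: "v \<in> sphere 0 1 \<inter> W" and max: "\<And>u. u \<in> sphere 0 1 \<inter> W \<Longrightarrow> r u \<le> r v"
    using continuous_attains_sup by metis
  have "v \<noteq> 0" using v by auto
  have bound: "inner_pi \<pi> (T u) u \<le> r v * inner_pi \<pi> u u" if "u \<in> W" for u
  proof (cases "u = 0")
    case False
    have "r ((1 / norm u) *\<^sub>R u) = r u"
      using False by (simp add: r_def linear_scale[OF \<open>linear T\<close>] inner_pi_simps)
    with max[OF unit[OF that False]] have "r u \<le> r v" by simp
    with inner_pi_pos[OF False] show ?thesis by (simp add: r_def pos_divide_le_eq)
  qed (simp add: linear_0[OF \<open>linear T\<close>])
  \<comment> \<open>By maximality the form of \<open>L\<close> is nonnegative on \<open>W\<close>,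
    and it vanishes at v. Cauchy-Schwarz against L v then gives <L v, L v> = 0, so v is an
    eigenvector.\<close>
  define L where "L u = r v *\<^sub>R u - T u" for u
  have "linear L" unfolding L_def
    by (rule linearI) (simp_all add: linear_add[OF \<open>linear T\<close>] linear_scale[OF \<open>linear T\<close>] algebra_simps)
  have "L v \<in> W"
    using v inv \<open>subspace W\<close> by (simp add: L_def subspace_diff subspace_scale)
  have "(inner_pi \<pi> (L v) (L v))\<^sup>2 \<le> inner_pi \<pi> (L v) v * inner_pi \<pi> (L (L v)) (L v)"
    using \<open>linear L\<close> _ \<open>subspace W\<close> _ _ \<open>L v \<in> W\<close>
    by (rule psd_form_Cauchy_Schwarz) (use v bound in \<open>simp_all add: L_def inner_pi_simps flip: sym\<close>)
  moreover have "inner_pi \<pi> (L v) v = 0"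
    using inner_pi_pos[OF \<open>v \<noteq> 0\<close>] by (simp add: L_def inner_pi_simps r_def)
  ultimately have "L v = 0" by (simp add: inner_pi_eq_0)
  with that[of v "r v"] v \<open>v \<noteq> 0\<close> bound show thesis by (simp add: L_def)
qed

text \<open>Eigenvectors of distinct eigenvalues are orthogonal for the weighted inner product;
  multiplying coordinates by sqrt(\<pi>(x)) makes them orthogonal in the Euclidean sense, hence
  independent. Finiteness makes the \<open>Max\<close> and \<open>Min\<close> in the spectral
  quantities meaningful.\<close>

lemma finite_eigenvalues: "finite {k. is_eigenvalue P k}"
proof -
  define v where "v k = (SOME v. v \<noteq> 0 \<and> P *v v = k *\<^sub>R v)" for k
  have v: "v k \<noteq> 0 \<and> P *v v k = k *\<^sub>R v k" if "is_eigenvalue P k" for k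
    using that unfolding is_eigenvalue_def v_def by (rule someI_ex)
  define w :: "real \<Rightarrow> real^'v" where "w k = (\<chi> x. sqrt (\<pi> x) * v k $ x)" for k
  have ip: "w k \<bullet> w l = inner_pi \<pi> (v k) (v l)" for k l
  proof -
    have "(sqrt (\<pi> x) * v k $ x) * (sqrt (\<pi> x) * v l $ x) = \<pi> x * v k $ x * v l $ x" for x
    proof -
      have "(sqrt (\<pi> x) * a) * (sqrt (\<pi> x) * b) = (sqrt (\<pi> x) * sqrt (\<pi> x)) * a * b" for a b
        by (simp only: mult_ac)
      then show ?thesis using \<pi>_nonneg[of x] by simp
    qed
    then show ?thesis
      by (simp only: w_def inner_vec_def inner_pi_def inner_real_def vec_lambda_beta)
  qed
  have orth: "w k \<bullet> w l = 0" if "is_eigenvalue P k" "is_eigenvalue P l" "k \<noteq> l" for k l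
    using P_self_adjoint[of "v k" "v l"] v[OF that(1)] v[OF that(2)] that(3)
    by (simp add: ip inner_pi_simps)
  have nz: "w k \<noteq> 0" if "is_eigenvalue P k" for k
    using ip[of k k] inner_pi_pos v[OF that] by fastforce
  have "independent (w ` {k. is_eigenvalue P k})"
    by (rule pairwise_orthogonal_independent) (use orth nz in \<open>auto simp: pairwise_def orthogonal_def\<close>)
  then have "finite (w ` {k. is_eigenvalue P k})"
    by (rule finiteI_independent)
  moreover have "inj_on w {k. is_eigenvalue P k}"
    by (rule inj_onI) (metis (mono_tags) mem_Collect_eq orth nz inner_eq_zero_iff)
  ultimately show ?thesis by (rule finite_imageD)
qed

lemma mean_0_subspace: "subspace {u. inner_pi \<pi> 1 u = 0}"
  by (auto simp: subspace_def inner_pi_simps)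

lemma eigenvalue_lt_1:
  assumes "is_eigenvalue P k" "k \<noteq> 1"
  shows "k < 1"
proof -
  obtain v where v: "v \<noteq> 0" "P *v v = k *\<^sub>R v"
    using assms by (auto simp: is_eigenvalue_def)
  have "(1 - k) * inner_pi \<pi> v v \<ge> 0"
    using dirichlet_nonneg[of v] v by (simp add: inner_pi_simps algebra_simps)
  with inner_pi_pos[OF v(1)] assms(2) show ?thesis
    by (simp add: zero_le_mult_iff)
qed

text \<open>The eigenvalue is the maximal Rayleigh quotient over mean-zero functions. It differs
  from 1 because a harmonic function of mean zero vanishes. Two distinct states are what makes this
  subspace nontrivial.\<close>

lemma eigenvalue_ne_1_exists:
  assumes "\<exists>x y::'v. x \<noteq> y"
  obtains k where "is_eigenvalue P k" "k \<noteq> 1"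
    "\<And>u. inner_pi \<pi> 1 u = 0 \<Longrightarrow> inner_pi \<pi> (P *v u) u \<le> k * inner_pi \<pi> u u"
proof -
  obtain x y :: 'v where xy: "x \<noteq> y" using assms by blast
  \<comment> \<open>The two values are chosen so that \<pi>(x) \<pi>(y) - \<pi>(y) \<pi>(x) = 0 is
    the mean.\<close>
  define h :: "real^'v" where "h = (\<chi> z. if z = x then \<pi> y else if z = y then - \<pi> x else 0)"
  have "(\<Sum>z\<in>UNIV. \<pi> z * h $ z) = (\<Sum>z\<in>{x, y}. \<pi> z * h $ z)"
    by (rule sum.mono_neutral_right) (auto simp: h_def)
  also have "\<dots> = 0" using xy by (simp add: h_def)
  finally have "inner_pi \<pi> 1 h = 0" by (simp add: inner_pi_one)
  moreover have "h \<noteq> 0" using \<pi>_pos[of y] by (auto simp: h_def vec_eq_iff)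
  ultimately have W: "{u. inner_pi \<pi> 1 u = 0} \<noteq> {0}" by blast
  obtain m v where mv: "v \<in> {u. inner_pi \<pi> 1 u = 0}" "v \<noteq> 0" "P *v v = m *\<^sub>R v"
    "\<And>u. u \<in> {u. inner_pi \<pi> 1 u = 0} \<Longrightarrow> inner_pi \<pi> (P *v u) u \<le> m * inner_pi \<pi> u u"
    by (rule rayleigh_max[OF mean_0_subspace W, of "\<lambda>u. P *v u"])
      (auto simp: inner_pi_one_P P_self_adjoint)
  moreover have "m \<noteq> 1"
    using harmonic_mean_0_imp_0[of v] mv by auto
  ultimately show thesis
    using that[of m] by (auto simp: is_eigenvalue_def)
qed

text \<open>The maximal mean-zero Rayleigh quotient k is an eigenvalue other than 1, hence at most
  the maximum \<open>K\<close> defining the gap; replacing k by \<open>K\<close> yields the gap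
  inequality. The bound by the smallest eigenvalue comes from the Rayleigh maximum of -P.\<close>

lemma
  assumes "\<exists>x y::'v. x \<noteq> y"
  shows spectral_gap_pos: "spectral_gap P > 0"
    and spectral_gap_le: "inner_pi \<pi> 1 u = 0 \<Longrightarrow> spectral_gap P * inner_pi \<pi> u u \<le> inner_pi \<pi> (u - P *v u) u"
    and min_eigenvalue_less_1: "min_eigenvalue P < 1"
    and le_min_eigenvalue: "inner_pi \<pi> (v - P *v v) v \<le> (1 - min_eigenvalue P) * inner_pi \<pi> v v"
proof -
  obtain k where k: "is_eigenvalue P k" "k \<noteq> 1"
    "\<And>u. inner_pi \<pi> 1 u = 0 \<Longrightarrow> inner_pi \<pi> (P *v u) u \<le> k * inner_pi \<pi> u u"
    using eigenvalue_ne_1_exists[OF assms] by metis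
  have fin: "finite {k. is_eigenvalue P k \<and> k \<noteq> 1}"
    using finite_eigenvalues by (rule rev_finite_subset) auto
  define K where "K = Max {k. is_eigenvalue P k \<and> k \<noteq> 1}"
  have "K \<in> {k. is_eigenvalue P k \<and> k \<noteq> 1}"
    unfolding K_def using k by (intro Max_in[OF fin]) auto
  then show "spectral_gap P > 0"
    using eigenvalue_lt_1[of K] by (simp add: spectral_gap_def flip: K_def)
  have "k \<le> K" unfolding K_def using k by (intro Max_ge[OF fin]) auto
  show "spectral_gap P * inner_pi \<pi> u u \<le> inner_pi \<pi> (u - P *v u) u" if "inner_pi \<pi> 1 u = 0"
    using k(3)[OF that] mult_right_mono[OF \<open>k \<le> K\<close> inner_pi_nonneg[of u]]
    by (simp add: spectral_gap_def inner_pi_simps algebra_simps flip: K_def)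
  have min_le: "min_eigenvalue P \<le> l" if "is_eigenvalue P l" for l
    unfolding min_eigenvalue_def using that by (intro Min_le[OF finite_eigenvalues]) auto
  show "min_eigenvalue P < 1"
    using min_le[OF k(1)] eigenvalue_lt_1[OF k(1,2)] by simp
  have "(UNIV :: (real^'v) set) \<noteq> {0}"
    by (metis UNIV_I singletonD zero_neq_one)
  \<comment> \<open>The largest Rayleigh quotient m of -P is attained at an eigenvector, so -m is an
    eigenvalue of P and bounds the smallest one from above.\<close>
  then obtain m w where mw: "w \<noteq> 0" "- (P *v w) = m *\<^sub>R w"
    "\<And>u. inner_pi \<pi> (- (P *v u)) u \<le> m * inner_pi \<pi> u u"
    by (rule rayleigh_max[OF subspace_UNIV, of "\<lambda>u. - (P *v u)"])
      (auto simp: linear_compose_neg inner_pi_diff_left[of _ 0, simplified]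
        inner_pi_diff_right[of _ _ 0, simplified] P_self_adjoint)
  have "P *v w = (- m) *\<^sub>R w"
    using mw(2) by (metis minus_minus scaleR_minus_left)
  then have "min_eigenvalue P \<le> - m"
    using mw(1) by (intro min_le) (auto simp: is_eigenvalue_def)
  from mult_right_mono[OF this inner_pi_nonneg[of v]] mw(3)[of v]
  show "inner_pi \<pi> (v - P *v v) v \<le> (1 - min_eigenvalue P) * inner_pi \<pi> v v"
    by (simp add: inner_pi_simps inner_pi_diff_left[of _ 0, simplified] algebra_simps)
qed

text \<open>Let u be the solution of (I - P) u = h and q = <u,h>, which is also the Dirichlet form
  of u. Upper bound: q^2 <= <u,u> <h,h>, and the gap times <u,u> is at most q. Lower bound:
  Cauchy-Schwarz for the form of I - P gives <h,h>^2 <= q <(I - P) h, h>, where the last factor is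
  at most (1 - \<gamma>) <h,h> for the smallest eigenvalue \<gamma>.\<close>

lemma
  assumes ex: "\<exists>x y::'v. x \<noteq> y" and h: "inner_pi \<pi> 1 h = 0"
  shows inv_I_minus_upper: "inner_pi \<pi> (inv_I_minus P \<pi> h) h \<le> inner_pi \<pi> h h / spectral_gap P"
    and inv_I_minus_lower: "inner_pi \<pi> h h / (1 - min_eigenvalue P) \<le> inner_pi \<pi> (inv_I_minus P \<pi> h) h"
proof -
  define u where "u = inv_I_minus P \<pi> h"
  define L where "L u = u - P *v u" for u
  have u: "L u = h" "inner_pi \<pi> 1 u = 0"
    using inv_I_minus_props[OF h] by (simp_all add: u_def L_def)
  have linL: "linear L" unfolding L_def
    by (intro linear_compose_sub linear_id[unfolded id_def]) simp
  have sym: "inner_pi \<pi> (L u) v = inner_pi \<pi> u (L v)" for u v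
    by (simp add: L_def inner_pi_simps P_self_adjoint)
  note CS = psd_form_Cauchy_Schwarz[OF _ _ subspace_UNIV]
  define q where "q = inner_pi \<pi> u h"
  have q: "q = inner_pi \<pi> (L u) u" using u(1) by (simp add: q_def inner_pi_commute)
  have "q \<ge> 0" using dirichlet_nonneg[of u] by (simp add: q L_def)
  have "q\<^sup>2 \<le> inner_pi \<pi> u u * inner_pi \<pi> h h"
    unfolding q_def by (rule CS[of "\<lambda>x. x"]) (auto simp: inner_pi_nonneg linear_id[unfolded id_def])
  moreover have gap: "spectral_gap P * inner_pi \<pi> u u \<le> q"
    using spectral_gap_le[OF ex u(2)] by (simp add: q L_def)
  ultimately have "spectral_gap P * q\<^sup>2 \<le> q * inner_pi \<pi> h h"
    using spectral_gap_pos[OF ex] inner_pi_nonneg[of h]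
    by (smt (verit, best) mult.assoc mult_left_mono mult_right_mono)
  then have "spectral_gap P * q \<le> inner_pi \<pi> h h"
    using \<open>q \<ge> 0\<close> inner_pi_nonneg[of h]
    by (cases "q = 0") (auto simp: power2_eq_square)
  then show "inner_pi \<pi> (inv_I_minus P \<pi> h) h \<le> inner_pi \<pi> h h / spectral_gap P"
    using spectral_gap_pos[OF ex] by (simp add: pos_le_divide_eq mult.commute flip: u_def q_def)
  have "(inner_pi \<pi> (L u) h)\<^sup>2 \<le> inner_pi \<pi> (L u) u * inner_pi \<pi> (L h) h"
    by (rule CS[OF linL]) (auto simp: sym, use dirichlet_nonneg sym in \<open>simp add: L_def\<close>)
  also have "\<dots> \<le> q * ((1 - min_eigenvalue P) * inner_pi \<pi> h h)"
    unfolding q using le_min_eigenvalue[OF ex, of h] \<open>q \<ge> 0\<close>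
    by (intro mult_left_mono) (auto simp: L_def q)
  finally have "inner_pi \<pi> h h \<le> q * (1 - min_eigenvalue P)"
    using inner_pi_nonneg[of h] \<open>q \<ge> 0\<close> min_eigenvalue_less_1[OF ex] u(1)
    by (cases "inner_pi \<pi> h h = 0") (auto simp: power2_eq_square mult.assoc[symmetric])
  then show "inner_pi \<pi> h h / (1 - min_eigenvalue P) \<le> inner_pi \<pi> (inv_I_minus P \<pi> h) h"
    using min_eigenvalue_less_1[OF ex] by (simp add: pos_divide_le_eq flip: u_def q_def)
qed

section \<open>Stationary distributions of the chain and of the edge-walk\<close>

text \<open>By detailed balance the density \<mu>/\<pi> is harmonic, hence constant, and the total
  mass fixes the constant as 1.\<close>

lemma stationary_unique:
  assumes "\<And>y. (\<Sum>x\<in>UNIV. \<mu> x * P $ x $ y) = \<mu> y" "(\<Sum>x\<in>UNIV. \<mu> x) = 1"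
  shows "\<mu> x = \<pi> x"
proof -
  define w :: "real^'v" where "w = (\<chi> x. \<mu> x / \<pi> x)"
  have \<mu>: "\<mu> x = \<pi> x * w $ x" for x using \<pi>_pos[of x] by (simp add: w_def)
  have "\<pi> y * (P *v w) $ y = \<pi> y * w $ y" for y
  proof -
    have "\<pi> y * w $ y = (\<Sum>x\<in>UNIV. w $ x * (\<pi> x * P $ x $ y))"
      using assms(1)[of y] by (simp add: \<mu> mult_ac)
    also have "\<dots> = (\<Sum>x\<in>UNIV. w $ x * (\<pi> y * P $ y $ x))"
      by (subst balance) simp
    also have "\<dots> = \<pi> y * (P *v w) $ y"
      by (simp add: matrix_vector_mult_def sum_distrib_left mult_ac)
    finally show ?thesis ..
  qed
  then have "P *v w = w" using \<pi>_pos by (simp add: vec_eq_iff) (metis less_irrefl)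
  then have c: "w $ y = w $ x" for y by (rule harmonic_imp_const)
  have "1 = (\<Sum>y\<in>UNIV. \<pi> y * w $ x)"
    using assms(2) unfolding \<mu> by (subst (asm) c) simp
  then have "w $ x = 1" by (simp add: sum_\<pi> flip: sum_distrib_right)
  then show ?thesis by (simp add: \<mu>)
qed

text \<open>Let \<mu>(x) be the mass of edge states ending at x. A predecessor of (y,z) must end at
  y, so stationarity says that (y,z) has mass \<mu>(y) P(y,z). Summing over the first endpoint shows
  that \<mu> is stationary for P, hence equal to \<pi>.\<close>

lemma edge_stationary:
  assumes st: "stationary_dist (edge_states P) (edge_kernel P) \<pi>E" and "P $ x $ y \<noteq> 0"
  shows "\<pi>E (x, y) = \<pi> x * P $ x $ y"
proof -
  define \<mu> where "\<mu> x = (\<Sum>a\<in>{a \<in> edge_states P. snd a = x}. \<pi>E a)" for x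
  have E: "\<pi>E (y, z) = \<mu> y * P $ y $ z" if "P $ y $ z \<noteq> 0" for y z
  proof -
    have "\<pi>E (y, z) = (\<Sum>a\<in>edge_states P. \<pi>E a * edge_kernel P a (y, z))"
      using st that by (simp add: stationary_dist_def edge_states_def)
    also have "\<dots> = (\<Sum>a\<in>edge_states P. if snd a = y then \<pi>E a * P $ y $ z else 0)"
      by (intro sum.cong) (auto simp: edge_kernel_def)
    also have "\<dots> = \<mu> y * P $ y $ z"
      by (simp add: \<mu>_def sum_distrib_right sum.If_cases Int_def)
    finally show ?thesis .
  qed
  have "(\<Sum>x\<in>UNIV. \<mu> x * P $ x $ y) = \<mu> y" for y
  proof -
    have "\<mu> y = (\<Sum>x\<in>{x. P $ x $ y \<noteq> 0}. \<pi>E (x, y))"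
      unfolding \<mu>_def
      by (rule sum.reindex_bij_witness[of _ "\<lambda>x. (x, y)" fst]) (auto simp: edge_states_def)
    also have "\<dots> = (\<Sum>x\<in>{x. P $ x $ y \<noteq> 0}. \<mu> x * P $ x $ y)"
      by (rule sum.cong) (auto simp: E)
    also have "\<dots> = (\<Sum>x\<in>UNIV. \<mu> x * P $ x $ y)"
      by (rule sum.mono_neutral_left) auto
    finally show ?thesis by simp
  qed
  moreover have "(\<Sum>x\<in>UNIV. \<mu> x) = 1"
  proof -
    have "(\<Sum>x\<in>UNIV. \<mu> x) = (\<Sum>a\<in>edge_states P. \<pi>E a)"
      unfolding \<mu>_def by (rule sum.group) auto
    then show ?thesis using st by (simp add: stationary_dist_def)
  qed
  ultimately have "\<mu> x = \<pi> x" by (rule stationary_unique)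
  with E[OF assms(2)] show ?thesis by simp
qed

section \<open>Linearity and symmetry of the inverse of I - P on mean-zero functions\<close>

lemma inv_I_minus_unique:
  assumes "u - P *v u = h" "inner_pi \<pi> 1 u = 0"
  shows "inv_I_minus P \<pi> h = u"
proof -
  have "inner_pi \<pi> 1 h = 0"
    unfolding assms(1)[symmetric] by (simp add: inner_pi_diff_right inner_pi_one_P)
  note v = inv_I_minus_props[OF this]
  have "inv_I_minus P \<pi> h - P *v inv_I_minus P \<pi> h = u - P *v u"
    using v(1) assms(1) by (rule trans[OF _ sym])
  then have "P *v (inv_I_minus P \<pi> h - u) = inv_I_minus P \<pi> h - u"
    by (simp add: matrix_vector_mult_diff_distrib algebra_simps)
  moreover have "inner_pi \<pi> 1 (inv_I_minus P \<pi> h - u) = 0"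
    using v(2) assms(2) by (simp add: inner_pi_diff_right)
  ultimately have "inv_I_minus P \<pi> h - u = 0" by (rule harmonic_mean_0_imp_0)
  then show ?thesis by simp
qed

lemma inv_I_minus_add:
  assumes "inner_pi \<pi> 1 h = 0" "inner_pi \<pi> 1 k = 0"
  shows "inv_I_minus P \<pi> (h + k) = inv_I_minus P \<pi> h + inv_I_minus P \<pi> k"
proof (rule inv_I_minus_unique)
  define u where "u = inv_I_minus P \<pi> h"
  define v where "v = inv_I_minus P \<pi> k"
  have "u + v - P *v (u + v) = (u - P *v u) + (v - P *v v)"
    by (simp add: matrix_vector_right_distrib)
  then show "inv_I_minus P \<pi> h + inv_I_minus P \<pi> k
      - P *v (inv_I_minus P \<pi> h + inv_I_minus P \<pi> k) = h + k"
    by (simp only: u_def v_def inv_I_minus_props[OF assms(1)] inv_I_minus_props[OF assms(2)])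
  show "inner_pi \<pi> 1 (inv_I_minus P \<pi> h + inv_I_minus P \<pi> k) = 0"
    by (simp add: inner_pi_add_right inv_I_minus_props assms)
qed

text \<open>With u and v the solutions for h and k, both sides are the symmetric form <u, (I - P)
  v>.\<close>

lemma inv_I_minus_self_adjoint:
  assumes "inner_pi \<pi> 1 h = 0" "inner_pi \<pi> 1 k = 0"
  shows "inner_pi \<pi> (inv_I_minus P \<pi> h) k = inner_pi \<pi> (inv_I_minus P \<pi> k) h"
proof -
  define u where "u = inv_I_minus P \<pi> h"
  define v where "v = inv_I_minus P \<pi> k"
  have u: "u - P *v u = h" and v: "v - P *v v = k"
    using inv_I_minus_props assms by (auto simp: u_def v_def)
  have "inner_pi \<pi> u (v - P *v v) = inner_pi \<pi> v (u - P *v u)"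
    by (simp add: inner_pi_diff_right inner_pi_commute[of \<pi> v] P_self_adjoint)
  then show ?thesis by (simp only: u v flip: u_def v_def)
qed

end

section \<open>Moments of additive functionals\<close>

lemma finite_fun_bounded:
  fixes f :: "'a::finite \<Rightarrow> real"
  obtains c where "c \<ge> 0" "\<And>x. \<bar>f x\<bar> \<le> c"
proof (rule that)
  show "(\<Sum>x\<in>UNIV. \<bar>f x\<bar>) \<ge> 0" by (simp add: sum_nonneg)
  show "\<bar>f x\<bar> \<le> (\<Sum>x\<in>UNIV. \<bar>f x\<bar>)" for x
    by (rule member_le_sum) auto
qed

text \<open>A pathwise substitute for measurability with respect to the states at times 0 to t. On a
  finite state space such a functional takes finitely many values, so integrability is
  automatic.\<close>

definition depends_upto :: "nat \<Rightarrow> ((nat \<Rightarrow> 'v) \<Rightarrow> real) \<Rightarrow> bool" where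
  "depends_upto t K \<longleftrightarrow> (\<forall>x y. (\<forall>s\<le>t. x s = y s) \<longrightarrow> K x = K y)"

definition add_fun :: "('v \<Rightarrow> 'v \<Rightarrow> real) \<Rightarrow> nat \<Rightarrow> (nat \<Rightarrow> 'v) \<Rightarrow> real" where
  "add_fun d t x = (\<Sum>s<t. d (x s) (x (Suc s)))"

lemma add_fun_Suc: "add_fun d (Suc t) x = add_fun d t x + d (x t) (x (Suc t))"
  by (simp add: add_fun_def)

lemma depends_upto_add_fun: "t \<le> t' \<Longrightarrow> depends_upto t' (add_fun d t)"
  by (auto simp: depends_upto_def add_fun_def intro!: sum.cong)

lemma depends_upto_mult: "depends_upto t F \<Longrightarrow> depends_upto t G \<Longrightarrow> depends_upto t (\<lambda>x. F x * G x)"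
  and depends_upto_power: "depends_upto t F \<Longrightarrow> depends_upto t (\<lambda>x. F x ^ n)"
  and depends_upto_abs: "depends_upto t F \<Longrightarrow> depends_upto t (\<lambda>x. \<bar>F x\<bar>)"
  and depends_upto_add: "depends_upto t F \<Longrightarrow> depends_upto t G \<Longrightarrow> depends_upto t (\<lambda>x. F x + G x)"
  and depends_upto_diff: "depends_upto t F \<Longrightarrow> depends_upto t G \<Longrightarrow> depends_upto t (\<lambda>x. F x - G x)"
  unfolding depends_upto_def by metis+

lemma depends_upto_const: "depends_upto t (\<lambda>x. c)"
  and depends_upto_coord: "s \<le> t \<Longrightarrow> depends_upto t (\<lambda>x. f (x s))"
  and depends_upto_coord2: "s \<le> t \<Longrightarrow> s' \<le> t \<Longrightarrow> depends_upto t (\<lambda>x. g (x s) (x s'))"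
  unfolding depends_upto_def by auto

lemmas depends_upto_intros = depends_upto_add_fun depends_upto_mult depends_upto_power
  depends_upto_abs depends_upto_add depends_upto_diff depends_upto_const depends_upto_coord
  depends_upto_coord2

locale finite_markov_chain =
  fixes M :: "'w measure" and X :: "nat \<Rightarrow> 'w \<Rightarrow> 'v::finite" and P :: "real^'v^'v"
  assumes markov: "markov_chain M X P" and stoch: "stochastic P"
begin

sublocale prob_space M
  using markov by (simp add: markov_chain_def)

lemma measurable_X [measurable]: "X t \<in> measurable M (count_space UNIV)"
  using markov by (simp add: markov_chain_def)

abbreviation path :: "'w \<Rightarrow> nat \<Rightarrow> 'v" where
  "path \<omega> \<equiv> \<lambda>s. X s \<omega>"

section \<open>The Markov property for path functionals\<close>

text \<open>The defining property conditions only on cylinders of nonzero probability; in product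
  form it extends to null cylinders, where both sides are 0.\<close>

lemma cylinder_step:
  "prob {\<omega> \<in> space M. (\<forall>s\<le>t. X s \<omega> = h s) \<and> X (Suc t) \<omega> = y} =
    P $ h t $ y * prob {\<omega> \<in> space M. \<forall>s\<le>t. X s \<omega> = h s}"
proof (cases "prob {\<omega> \<in> space M. \<forall>s\<le>t. X s \<omega> = h s} = 0")
  case True
  have "prob {\<omega> \<in> space M. (\<forall>s\<le>t. X s \<omega> = h s) \<and> X (Suc t) \<omega> = y} \<le>
      prob {\<omega> \<in> space M. \<forall>s\<le>t. X s \<omega> = h s}"
    by (intro finite_measure_mono) auto
  with True show ?thesis
    by (simp add: measure_le_0_iff)
next
  case False
  then have "cond_prob M (\<lambda>\<omega>. X (Suc t) \<omega> = y) (\<lambda>\<omega>. \<forall>s\<le>t. X s \<omega> = h s) = P $ h t $ y"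
    using markov by (simp add: markov_chain_def)
  with False show ?thesis
    by (simp add: cond_prob_def divide_eq_eq conj_commute)
qed

text \<open>A functional of the first t + 1 states is a finite combination of cylinder indicators.
  The event \<open>B\<close> leaves room for a condition on the next state.\<close>

lemma path_expectation:
  assumes "depends_upto t K" and [measurable]: "B \<in> events"
  shows "has_bochner_integral M (\<lambda>\<omega>. K (path \<omega>) * indicator B \<omega>)
    (\<Sum>h\<in>{..t} \<rightarrow>\<^sub>E UNIV. K h * prob ({\<omega> \<in> space M. \<forall>s\<le>t. X s \<omega> = h s} \<inter> B))"
proof -
  have eq: "K (path \<omega>) * indicator B \<omega> = (\<Sum>h\<in>{..t} \<rightarrow>\<^sub>E UNIV.
      K h * indicator ({\<omega> \<in> space M. \<forall>s\<le>t. X s \<omega> = h s} \<inter> B) \<omega>)" if "\<omega> \<in> space M" for \<omega>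
  proof -
    \<comment> \<open>Histories are extensional functions, so the restricted path is the only one
      matching \<omega> and a single summand survives.\<close>
    define h0 where "h0 = restrict (path \<omega>) {..t}"
    have h0: "h0 \<in> {..t} \<rightarrow>\<^sub>E UNIV" by (simp add: h0_def)
    have uniq: "h = h0" if "h \<in> {..t} \<rightarrow>\<^sub>E UNIV" "\<forall>s\<le>t. X s \<omega> = h s" for h
    proof (rule PiE_ext[OF that(1) h0])
      show "h s = h0 s" if "s \<in> {..t}" for s
        using that \<open>\<forall>s\<le>t. X s \<omega> = h s\<close> by (simp add: h0_def)
    qed
    have "(\<Sum>h\<in>{..t} \<rightarrow>\<^sub>E UNIV. K h * indicator ({\<omega> \<in> space M. \<forall>s\<le>t. X s \<omega> = h s} \<inter> B) \<omega>) =
       (\<Sum>h\<in>{h0}. K h * indicator ({\<omega> \<in> space M. \<forall>s\<le>t. X s \<omega> = h s} \<inter> B) \<omega>)"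
      using h0 uniq by (intro sum.mono_neutral_right) (auto simp: finite_PiE indicator_def)
    also have "\<dots> = K h0 * indicator B \<omega>"
      using that by (simp add: indicator_def) (simp add: h0_def)
    also have "K h0 = K (path \<omega>)"
      using assms(1) by (simp add: depends_upto_def h0_def)
    finally show ?thesis ..
  qed
  have "has_bochner_integral M (\<lambda>\<omega>. \<Sum>h\<in>{..t} \<rightarrow>\<^sub>E UNIV.
      K h * indicator ({\<omega> \<in> space M. \<forall>s\<le>t. X s \<omega> = h s} \<inter> B) \<omega>)
    (\<Sum>h\<in>{..t} \<rightarrow>\<^sub>E UNIV. K h * prob ({\<omega> \<in> space M. \<forall>s\<le>t. X s \<omega> = h s} \<inter> B))"
    by (intro has_bochner_integral_sum has_bochner_integral_mult_right
        has_bochner_integral_real_indicator) (auto simp: emeasure_eq_measure)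
  then show ?thesis
    by (rule has_bochner_integral_cong[THEN iffD1, rotated -1]) (simp_all add: eq)
qed

lemma integrable_path:
  assumes "depends_upto t K"
  shows "integrable M (\<lambda>\<omega>. K (path \<omega>))"
proof -
  have "integrable M (\<lambda>\<omega>. K (path \<omega>) * indicator (space M) \<omega>)"
    using path_expectation[OF assms, of "space M"] by (auto intro: integrable.intros)
  then show ?thesis
    by (rule Bochner_Integration.integrable_cong[THEN iffD1, rotated -1]) auto
qed

text \<open>Averaging the last step against the row of P leaves expectations weighted by the past
  unchanged. The left side is split by the value y of the next state and expanded into cylinders
  intersected with \<open>B y\<close>; \<open>cylinder_step\<close> turns each term into one over
  the whole space, which is then folded back.\<close>

lemma markov_expectation:
  assumes F: "depends_upto t F"
  shows "expectation (\<lambda>\<omega>. F (path \<omega>) * G (X t \<omega>) (X (Suc t) \<omega>)) =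
    expectation (\<lambda>\<omega>. F (path \<omega>) * (\<Sum>y\<in>UNIV. P $ X t \<omega> $ y * G (X t \<omega>) y))"
proof -
  define K where "K y x = F x * G (x t) y" for x y
  define B where "B y = {\<omega> \<in> space M. X (Suc t) \<omega> = y}" for y
  have B [measurable]: "B y \<in> events" for y unfolding B_def by simp
  have K: "depends_upto t (K y)" for y
    unfolding K_def by (intro depends_upto_intros F) simp
  have PK: "depends_upto t (\<lambda>x. P $ x t $ y * K y x)" for y
    by (intro depends_upto_intros K) simp
  have "expectation (\<lambda>\<omega>. F (path \<omega>) * G (X t \<omega>) (X (Suc t) \<omega>)) =
      expectation (\<lambda>\<omega>. \<Sum>y\<in>UNIV. K y (path \<omega>) * indicator (B y) \<omega>)"
  proof (rule Bochner_Integration.integral_cong)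
    fix \<omega> assume "\<omega> \<in> space M"
    then have "(\<Sum>y\<in>UNIV. K y (path \<omega>) * indicator (B y) \<omega>) =
        (\<Sum>y\<in>UNIV. if X (Suc t) \<omega> = y then K y (path \<omega>) else 0)"
      by (intro sum.cong) (auto simp: B_def indicator_def)
    then show "F (path \<omega>) * G (X t \<omega>) (X (Suc t) \<omega>) = (\<Sum>y\<in>UNIV. K y (path \<omega>) * indicator (B y) \<omega>)"
      by (simp add: K_def)
  qed simp
  also have "\<dots> = (\<Sum>y\<in>UNIV. \<Sum>h\<in>{..t} \<rightarrow>\<^sub>E UNIV. K y h * prob ({\<omega> \<in> space M. \<forall>s\<le>t. X s \<omega> = h s} \<inter> B y))"
    by (intro has_bochner_integral_integral_eq has_bochner_integral_sum path_expectation K B)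
  also have "\<dots> = (\<Sum>y\<in>UNIV. \<Sum>h\<in>{..t} \<rightarrow>\<^sub>E UNIV. P $ h t $ y * K y h *
      prob ({\<omega> \<in> space M. \<forall>s\<le>t. X s \<omega> = h s} \<inter> space M))"
  proof -
    have "{\<omega> \<in> space M. \<forall>s\<le>t. X s \<omega> = h s} \<inter> B y =
        {\<omega> \<in> space M. (\<forall>s\<le>t. X s \<omega> = h s) \<and> X (Suc t) \<omega> = y}" for h y
      by (auto simp: B_def)
    moreover have "{\<omega> \<in> space M. \<forall>s\<le>t. X s \<omega> = h s} \<inter> space M =
        {\<omega> \<in> space M. \<forall>s\<le>t. X s \<omega> = h s}" for h
      by auto
    ultimately show ?thesis
      by (simp only: cylinder_step mult_ac)
  qed
  also have "\<dots> = expectation (\<lambda>\<omega>. \<Sum>y\<in>UNIV. P $ X t \<omega> $ y * K y (path \<omega>) * indicator (space M) \<omega>)"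
    by (intro has_bochner_integral_integral_eq[symmetric] has_bochner_integral_sum
        path_expectation[where K = "\<lambda>x. P $ x t $ y * K y x" for y] PK sets.top)
  also have "\<dots> = expectation (\<lambda>\<omega>. F (path \<omega>) * (\<Sum>y\<in>UNIV. P $ X t \<omega> $ y * G (X t \<omega>) y))"
    by (intro Bochner_Integration.integral_cong) (auto simp: K_def sum_distrib_left mult_ac)
  finally show ?thesis .
qed

lemma expectation_poisson:
  "expectation (\<lambda>\<omega>. h (X (Suc t) \<omega>)) = expectation (\<lambda>\<omega>. \<Sum>y\<in>UNIV. P $ X t \<omega> $ y * h y)"
  using markov_expectation[of t "\<lambda>_. 1" "\<lambda>_ y. h y"] by (simp add: depends_upto_const)

section \<open>Second and fourth moments of martingale additive functionals\<close>

text \<open>In the expanded square the cross term vanishes, because given the past the next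
  increment has mean zero.\<close>

lemma martingale_second_moment:
  assumes mart: "\<And>x. (\<Sum>y\<in>UNIV. P $ x $ y * d x y) = 0"
  shows "expectation (\<lambda>\<omega>. (add_fun d (Suc t) (path \<omega>))\<^sup>2) =
    expectation (\<lambda>\<omega>. (add_fun d t (path \<omega>))\<^sup>2) +
    expectation (\<lambda>\<omega>. \<Sum>y\<in>UNIV. P $ X t \<omega> $ y * (d (X t \<omega>) y)\<^sup>2)"
proof -
  have int: "integrable M (\<lambda>\<omega>. (add_fun d t (path \<omega>))\<^sup>2)"
      "integrable M (\<lambda>\<omega>. 2 * (add_fun d t (path \<omega>) * d (X t \<omega>) (X (Suc t) \<omega>)))"
      "integrable M (\<lambda>\<omega>. (d (X t \<omega>) (X (Suc t) \<omega>))\<^sup>2)"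
    by (rule integrable_path[of "Suc t" "\<lambda>x. (add_fun d t x)\<^sup>2"]
          integrable_path[of "Suc t" "\<lambda>x. 2 * (add_fun d t x * d (x t) (x (Suc t)))"]
          integrable_path[of "Suc t" "\<lambda>x. (d (x t) (x (Suc t)))\<^sup>2"],
        intro depends_upto_intros; simp)+
  have "expectation (\<lambda>\<omega>. (add_fun d (Suc t) (path \<omega>))\<^sup>2) =
      expectation (\<lambda>\<omega>. (add_fun d t (path \<omega>))\<^sup>2
        + 2 * (add_fun d t (path \<omega>) * d (X t \<omega>) (X (Suc t) \<omega>)) + (d (X t \<omega>) (X (Suc t) \<omega>))\<^sup>2)"
    by (simp add: add_fun_Suc power2_eq_square algebra_simps)
  also have "\<dots> = expectation (\<lambda>\<omega>. (add_fun d t (path \<omega>))\<^sup>2)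
        + 2 * expectation (\<lambda>\<omega>. add_fun d t (path \<omega>) * d (X t \<omega>) (X (Suc t) \<omega>))
        + expectation (\<lambda>\<omega>. (d (X t \<omega>) (X (Suc t) \<omega>))\<^sup>2)"
    using int by simp
  also have "expectation (\<lambda>\<omega>. add_fun d t (path \<omega>) * d (X t \<omega>) (X (Suc t) \<omega>)) = 0"
    by (subst markov_expectation) (simp_all add: mart depends_upto_intros)
  also have "expectation (\<lambda>\<omega>. (d (X t \<omega>) (X (Suc t) \<omega>))\<^sup>2) =
      expectation (\<lambda>\<omega>. \<Sum>y\<in>UNIV. P $ X t \<omega> $ y * (d (X t \<omega>) y)\<^sup>2)"
    using markov_expectation[of t "\<lambda>_. 1" "\<lambda>x y. (d x y)\<^sup>2"] by (simp add: depends_upto_const)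
  finally show ?thesis by simp
qed

text \<open>The conditional variance of an increment is the constant v plus a coboundary h - P h,
  and the expectations of the coboundary telescope along the chain. The initial distribution enters
  only through the two boundary terms.\<close>

lemma martingale_variance:
  assumes mart: "\<And>x. (\<Sum>y\<in>UNIV. P $ x $ y * d x y) = 0"
    and poisson: "\<And>x. (\<Sum>y\<in>UNIV. P $ x $ y * (d x y)\<^sup>2) = v + h x - (\<Sum>y\<in>UNIV. P $ x $ y * h y)"
  shows "expectation (\<lambda>\<omega>. (add_fun d t (path \<omega>))\<^sup>2) =
    t * v + expectation (\<lambda>\<omega>. h (X 0 \<omega>)) - expectation (\<lambda>\<omega>. h (X t \<omega>))"
proof (induction t)
  case (Suc t)
  have int: "integrable M (\<lambda>\<omega>. h (X t \<omega>))" "integrable M (\<lambda>\<omega>. \<Sum>y\<in>UNIV. P $ X t \<omega> $ y * h y)"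
    by (rule integrable_path[of t "\<lambda>x. h (x t)"]
        integrable_path[of t "\<lambda>x. \<Sum>y\<in>UNIV. P $ x t $ y * h y"], simp add: depends_upto_def)+
  show ?case
    unfolding martingale_second_moment[of d, OF mart] poisson Suc.IH
    using int by (simp add: expectation_poisson algebra_simps prob_space)
qed (simp add: add_fun_def)

lemma martingale_second_moment_bound:
  assumes mart: "\<And>x. (\<Sum>y\<in>UNIV. P $ x $ y * d x y) = 0" and bd: "\<And>x y. \<bar>d x y\<bar> \<le> c"
  shows "expectation (\<lambda>\<omega>. (add_fun d t (path \<omega>))\<^sup>2) \<le> c\<^sup>2 * t"
proof (induction t)
  case (Suc t)
  have sq: "(d x y)\<^sup>2 \<le> c\<^sup>2" for x y
    using power_mono[OF bd[of x y], of 2] by simp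
  have "(\<Sum>y\<in>UNIV. P $ x $ y * (d x y)\<^sup>2) \<le> (\<Sum>y\<in>UNIV. P $ x $ y * c\<^sup>2)" for x
    using stoch sq by (intro sum_mono mult_left_mono) (auto simp: stochastic_def)
  also have "(\<Sum>y\<in>UNIV. P $ x $ y * c\<^sup>2) = c\<^sup>2" for x
    using stoch by (simp add: stochastic_def flip: sum_distrib_right)
  finally have "expectation (\<lambda>\<omega>. \<Sum>y\<in>UNIV. P $ X t \<omega> $ y * (d (X t \<omega>) y)\<^sup>2) \<le> c\<^sup>2"
    using integrable_path[of t "\<lambda>x. \<Sum>y\<in>UNIV. P $ x t $ y * (d (x t) y)\<^sup>2"]
    by (intro integral_le_const) (auto simp: depends_upto_def)
  with Suc.IH show ?case
    by (simp add: martingale_second_moment[of d, OF mart] algebra_simps)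
qed (simp add: add_fun_def)

text \<open>In one step the fourth moment grows by at most 8 c^2 E[S_t^2] + 3 c^4 <= 8 c^4 t + 3
  c^4, because the term with S_t^3 has mean zero. The growth of 4 c^4 t^2 is 8 c^4 t + 4 c^4, which
  is enough.\<close>

lemma martingale_fourth_moment_bound:
  assumes mart: "\<And>x. (\<Sum>y\<in>UNIV. P $ x $ y * d x y) = 0" and bd: "\<And>x y. \<bar>d x y\<bar> \<le> c"
  shows "expectation (\<lambda>\<omega>. (add_fun d t (path \<omega>)) ^ 4) \<le> 4 * c ^ 4 * (real t)\<^sup>2"
proof (induction t)
  case (Suc t)
  have sq: "(d x y)\<^sup>2 \<le> c\<^sup>2" for x y
    using power_mono[OF bd[of x y], of 2] by simp
  \<comment> \<open>Subtracting the square 2 a^2 (s - a)^2 accounts for the term 4 s a^3, whose sign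
    is unknown.\<close>
  have pointwise: "(s + a) ^ 4 \<le> s ^ 4 + 4 * (s ^ 3 * a) + 8 * c\<^sup>2 * s\<^sup>2 + 3 * c ^ 4"
    if "a\<^sup>2 \<le> c\<^sup>2" for s a :: real
  proof -
    have "(s + a) ^ 4 = s ^ 4 + 4 * (s ^ 3 * a) + 8 * a\<^sup>2 * s\<^sup>2 + 3 * (a\<^sup>2)\<^sup>2 - 2 * (a * (s - a))\<^sup>2"
      by (simp add: power2_eq_square power4_eq_xxxx power3_eq_cube algebra_simps)
    also have "\<dots> \<le> s ^ 4 + 4 * (s ^ 3 * a) + 8 * a\<^sup>2 * s\<^sup>2 + 3 * (a\<^sup>2)\<^sup>2"
      by simp
    also have "\<dots> \<le> s ^ 4 + 4 * (s ^ 3 * a) + 8 * c\<^sup>2 * s\<^sup>2 + 3 * (c\<^sup>2)\<^sup>2"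
      using mult_right_mono[OF that, of "s\<^sup>2"] power_mono[OF that, of 2] by simp
    finally show ?thesis by simp
  qed
  have int: "integrable M (\<lambda>\<omega>. (add_fun d t (path \<omega>)) ^ 4)"
      "integrable M (\<lambda>\<omega>. 4 * ((add_fun d t (path \<omega>)) ^ 3 * d (X t \<omega>) (X (Suc t) \<omega>)))"
      "integrable M (\<lambda>\<omega>. 8 * c\<^sup>2 * (add_fun d t (path \<omega>))\<^sup>2)"
      "integrable M (\<lambda>\<omega>. (add_fun d (Suc t) (path \<omega>)) ^ 4)"
    by (rule integrable_path[of "Suc t" "\<lambda>x. (add_fun d t x)^4"]
          integrable_path[of "Suc t" "\<lambda>x. 4 * ((add_fun d t x)^3 * d (x t) (x (Suc t)))"]
          integrable_path[of "Suc t" "\<lambda>x. 8 * c\<^sup>2 * (add_fun d t x)\<^sup>2"]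
          integrable_path[of "Suc t" "\<lambda>x. (add_fun d (Suc t) x)^4"],
        intro depends_upto_intros; simp)+
  have "expectation (\<lambda>\<omega>. (add_fun d (Suc t) (path \<omega>)) ^ 4) \<le>
      expectation (\<lambda>\<omega>. (add_fun d t (path \<omega>)) ^ 4
        + 4 * ((add_fun d t (path \<omega>)) ^ 3 * d (X t \<omega>) (X (Suc t) \<omega>))
        + 8 * c\<^sup>2 * (add_fun d t (path \<omega>))\<^sup>2 + 3 * c ^ 4)"
    using int by (intro integral_mono) (auto simp: add_fun_Suc intro!: pointwise sq)
  also have "\<dots> = expectation (\<lambda>\<omega>. (add_fun d t (path \<omega>)) ^ 4)
        + 4 * expectation (\<lambda>\<omega>. (add_fun d t (path \<omega>)) ^ 3 * d (X t \<omega>) (X (Suc t) \<omega>))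
        + 8 * c\<^sup>2 * expectation (\<lambda>\<omega>. (add_fun d t (path \<omega>))\<^sup>2) + 3 * c ^ 4"
    using int by (simp add: prob_space del: integrable_mult_left_iff integrable_mult_right_iff)
  also have "expectation (\<lambda>\<omega>. (add_fun d t (path \<omega>)) ^ 3 * d (X t \<omega>) (X (Suc t) \<omega>)) = 0"
    using markov_expectation[of t "\<lambda>x. (add_fun d t x) ^ 3" d]
    by (simp add: mart depends_upto_intros)
  also have "expectation (\<lambda>\<omega>. (add_fun d t (path \<omega>)) ^ 4) + 4 * 0
      + 8 * c\<^sup>2 * expectation (\<lambda>\<omega>. (add_fun d t (path \<omega>))\<^sup>2) + 3 * c ^ 4
      \<le> 4 * c ^ 4 * (real t)\<^sup>2 + 4 * 0 + 8 * c\<^sup>2 * (c\<^sup>2 * t) + 3 * c ^ 4"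
    by (intro add_mono mult_left_mono Suc.IH martingale_second_moment_bound[of d, OF mart bd]) auto
  also have "\<dots> \<le> 4 * c ^ 4 * (real (Suc t))\<^sup>2"
  proof -
    have "4 * c ^ 4 * (real (Suc t))\<^sup>2 = 4 * c ^ 4 * (real t)\<^sup>2 + 8 * c\<^sup>2 * (c\<^sup>2 * t) + 3 * c ^ 4 + (c\<^sup>2)\<^sup>2"
      by (simp add: algebra_simps power2_eq_square power4_eq_xxxx)
    then show ?thesis by simp
  qed
  finally show ?case .
qed (simp add: add_fun_def)

end

section \<open>Identification of the limiting variance\<close>

text \<open>Variance 0 is the point mass at 0 and is treated separately; otherwise the even moments
  of the normal density apply with standard deviation \<open>sqrt s\<close>.\<close>

lemma normal_dist_moments:
  assumes "s \<ge> 0"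
  shows "integrable (normal_dist s) (\<lambda>x. x\<^sup>2)" "integral\<^sup>L (normal_dist s) (\<lambda>x. x\<^sup>2) = s"
    and "integrable (normal_dist s) (\<lambda>x. x ^ 4)" "integral\<^sup>L (normal_dist s) (\<lambda>x. x ^ 4) = 3 * s\<^sup>2"
proof -
  have "has_bochner_integral (normal_dist s) (\<lambda>x. x\<^sup>2) s \<and>
      has_bochner_integral (normal_dist s) (\<lambda>x. x ^ 4) (3 * s\<^sup>2)"
  proof (cases "s = 0")
    case True
    interpret prob_space "return borel (0::real)" by (rule prob_space_return) simp
    have "integrable (return borel (0::real)) (\<lambda>x. x ^ n)" for n
      by (rule integrable_const_bound[where B = "0 ^ n"]) (auto simp: AE_return)
    then show ?thesis
      using True by (auto simp: normal_dist_def has_bochner_integral_iff integral_return)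
  next
    case False
    with assms have "sqrt s > 0" by simp
    have "has_bochner_integral (normal_dist s) (\<lambda>x. x ^ (2 * k)) (fact (2 * k) / ((2 / (sqrt s)\<^sup>2)^k * fact k))" for k
      using normal_moment_even[OF \<open>sqrt s > 0\<close>, of 0 k] False
      by (simp add: normal_dist_def has_bochner_integral_density)
    from this[of 1] this[of 2] show ?thesis
      using False assms by (simp add: power2_eq_square eval_nat_numeral field_simps)
  qed
  then show "integrable (normal_dist s) (\<lambda>x. x\<^sup>2)" "integral\<^sup>L (normal_dist s) (\<lambda>x. x\<^sup>2) = s"
    "integrable (normal_dist s) (\<lambda>x. x ^ 4)" "integral\<^sup>L (normal_dist s) (\<lambda>x. x ^ 4) = 3 * s\<^sup>2"
    by (simp_all add: has_bochner_integral_iff)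
qed

text \<open>For z = Z^2 the loss z - min z k is 0 if z <= k and at most z <= z^2 / k otherwise. The
  fourth moment thus provides uniform integrability of the squares.\<close>

lemma truncated_second_moment:
  fixes Z :: "'a \<Rightarrow> real"
  assumes "integrable N (\<lambda>x. (Z x)\<^sup>2)" "integrable N (\<lambda>x. (Z x) ^ 4)"
    and "integrable N (\<lambda>x. min ((Z x)\<^sup>2) k)" and "k > 0"
  shows "\<bar>integral\<^sup>L N (\<lambda>x. (Z x)\<^sup>2) - integral\<^sup>L N (\<lambda>x. min ((Z x)\<^sup>2) k)\<bar>
    \<le> integral\<^sup>L N (\<lambda>x. (Z x) ^ 4) / k"
proof -
  have "\<bar>integral\<^sup>L N (\<lambda>x. (Z x)\<^sup>2 - min ((Z x)\<^sup>2) k)\<bar> \<le> integral\<^sup>L N (\<lambda>x. \<bar>(Z x)\<^sup>2 - min ((Z x)\<^sup>2) k\<bar>)"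
    by (rule integral_abs_bound)
  also have "\<dots> \<le> integral\<^sup>L N (\<lambda>x. (Z x) ^ 4 / k)"
  proof (rule integral_mono)
    fix x
    have "\<bar>z - min z k\<bar> \<le> z\<^sup>2 / k" if "z \<ge> 0" for z
    proof (cases "z \<le> k")
      case False
      then have "z * k \<le> z * z" using that by (intro mult_left_mono) auto
      with \<open>k > 0\<close> have "z \<le> z\<^sup>2 / k" by (simp add: pos_le_divide_eq power2_eq_square)
      with False \<open>k > 0\<close> show ?thesis by simp
    qed (use \<open>k > 0\<close> in auto)
    from this[of "(Z x)\<^sup>2"] show "\<bar>(Z x)\<^sup>2 - min ((Z x)\<^sup>2) k\<bar> \<le> (Z x) ^ 4 / k"
      by simp
  qed (use assms in auto)
  also have "\<dots> = integral\<^sup>L N (\<lambda>x. (Z x) ^ 4) / k" by simp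
  finally show ?thesis using assms by simp
qed

text \<open>Convergence in distribution controls bounded continuous functions only, so the square is
  cut off at height k. The cut costs at most C/k uniformly in t >= 1 and at most 3 s^2 / k for the
  Gaussian, and k is arbitrary.\<close>

lemma limit_variance:
  assumes M: "prob_space M"
    and int: "\<And>t. integrable M (\<lambda>\<omega>. (Z t \<omega>)\<^sup>2)" "\<And>t. integrable M (\<lambda>\<omega>. (Z t \<omega>) ^ 4)"
    and meas [measurable]: "\<And>t. Z t \<in> borel_measurable M"
    and fourth: "\<And>t. t \<ge> 1 \<Longrightarrow> integral\<^sup>L M (\<lambda>\<omega>. (Z t \<omega>) ^ 4) \<le> C"
    and second: "(\<lambda>t. integral\<^sup>L M (\<lambda>\<omega>. (Z t \<omega>)\<^sup>2)) \<longlonglongrightarrow> v"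
    and conv: "\<And>k. k > 0 \<Longrightarrow> (\<lambda>t::nat. integral\<^sup>L M (\<lambda>\<omega>. min ((Z t \<omega>)\<^sup>2) k)) \<longlonglongrightarrow>
        integral\<^sup>L (normal_dist s) (\<lambda>x. min (x\<^sup>2) k)"
    and "s \<ge> 0"
  shows "v = s"
proof -
  interpret prob_space M by fact
  have bound: "\<bar>v - s\<bar> \<le> (C + 3 * s\<^sup>2) / k" if "k > 0" for k
  proof -
    define m where "m = integral\<^sup>L (normal_dist s) (\<lambda>x. min (x\<^sup>2) k)"
    have nonneg: "0 \<le> min ((z::real)\<^sup>2) k" for z using that by simp
    have "\<bar>integral\<^sup>L M (\<lambda>\<omega>. (Z t \<omega>)\<^sup>2) - integral\<^sup>L M (\<lambda>\<omega>. min ((Z t \<omega>)\<^sup>2) k)\<bar> \<le> C / k"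
      if "t \<ge> 1" for t
    proof -
      have "integrable M (\<lambda>\<omega>. min ((Z t \<omega>)\<^sup>2) k)"
        using nonneg by (intro integrable_const_bound[where B = k]) (auto intro!: AE_I2)
      from truncated_second_moment[OF int this \<open>k > 0\<close>]
      show ?thesis using divide_right_mono[OF fourth[OF that], of k] \<open>k > 0\<close> by simp
    qed
    then have "\<bar>v - m\<bar> \<le> C / k"
      unfolding m_def
      by (intro tendsto_upperbound[OF tendsto_rabs[OF tendsto_diff[OF second conv[OF that]]]])
        (auto simp: eventually_sequentially)
    moreover have "\<bar>s - m\<bar> \<le> 3 * s\<^sup>2 / k"
    proof -
      have [measurable_cong]: "sets (normal_dist s) = sets borel" by (simp add: normal_dist_def)
      have "integrable (normal_dist s) (\<lambda>x. min (x\<^sup>2) k)"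
        using normal_dist_moments(1)[OF \<open>s \<ge> 0\<close>]
        by (rule Bochner_Integration.integrable_bound)
          (measurable, use nonneg in auto)
      from truncated_second_moment[OF normal_dist_moments(1,3)[OF \<open>s \<ge> 0\<close>] this that]
      show ?thesis by (simp add: m_def normal_dist_moments[OF \<open>s \<ge> 0\<close>])
    qed
    ultimately show ?thesis by (simp add: add_divide_distrib)
  qed
  show ?thesis
  proof (rule ccontr)
    assume "v \<noteq> s"
    then have pos: "\<bar>v - s\<bar> > 0" by simp
    with bound[of 1] have "C + 3 * s\<^sup>2 > 0" by simp
    define A where "A = C + 3 * s\<^sup>2"
    have "A > 0" using \<open>C + 3 * s\<^sup>2 > 0\<close> by (simp add: A_def)
    \<comment> \<open>This height k makes the total truncation error half of the supposed
      discrepancy.\<close>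
    with pos have "\<bar>v - s\<bar> \<le> A / (2 * A / \<bar>v - s\<bar>)"
      using bound[of "2 * A / \<bar>v - s\<bar>"] by (simp flip: A_def)
    also have "\<dots> = \<bar>v - s\<bar> / 2" using \<open>A > 0\<close> by simp
    finally show False using pos by simp
  qed
qed

section \<open>Asymptotic variance under reversibility\<close>

context reversible_chain
begin

definition drift :: "('v \<Rightarrow> 'v \<Rightarrow> real) \<Rightarrow> real^'v" where
  "drift \<phi> = (\<chi> x. \<Sum>y\<in>UNIV. P $ x $ y * \<phi> x y)"

text \<open>The added difference of g = (I - P)^(-1) \<open>drift \<phi>\<close> cancels the
  conditional mean of \<phi> when the drift has mean zero.\<close>

definition martingale_increment :: "('v \<Rightarrow> 'v \<Rightarrow> real) \<Rightarrow> 'v \<Rightarrow> 'v \<Rightarrow> real" where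
  "martingale_increment \<phi> x y =
    \<phi> x y + inv_I_minus P \<pi> (drift \<phi>) $ y - inv_I_minus P \<pi> (drift \<phi>) $ x"

text \<open>\<pi>(x) P(x,y) is the stationary law of a single step, so this is the stationary second
  moment of an increment.\<close>

definition asymptotic_variance :: "('v \<Rightarrow> 'v \<Rightarrow> real) \<Rightarrow> real" where
  "asymptotic_variance \<phi> =
    (\<Sum>x\<in>UNIV. \<Sum>y\<in>UNIV. \<pi> x * P $ x $ y * (martingale_increment \<phi> x y)\<^sup>2)"

text \<open>Time reversal: detailed balance makes the stationary flow \<pi>(x) P(x,y) symmetric in x
  and y.\<close>

lemma flow_swap:
  "(\<Sum>x\<in>UNIV. \<Sum>y\<in>UNIV. \<pi> x * P $ x $ y * F x y) = (\<Sum>x\<in>UNIV. \<Sum>y\<in>UNIV. \<pi> x * P $ x $ y * F y x)"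
proof -
  have "(\<Sum>x\<in>UNIV. \<Sum>y\<in>UNIV. \<pi> x * P $ x $ y * F x y) =
      (\<Sum>x\<in>UNIV. \<Sum>y\<in>UNIV. \<pi> y * P $ y $ x * F y x)"
    by (rule sum.swap)
  also have "\<dots> = (\<Sum>x\<in>UNIV. \<Sum>y\<in>UNIV. \<pi> x * P $ x $ y * F y x)"
    by (intro sum.cong refl) (metis balance)
  finally show ?thesis .
qed

lemma inner_pi_drift:
  "inner_pi \<pi> u (drift \<phi>) = (\<Sum>x\<in>UNIV. \<Sum>y\<in>UNIV. \<pi> x * P $ x $ y * (u $ x * \<phi> x y))"
  by (simp add: inner_pi_def drift_def sum_distrib_left mult_ac)

text \<open>Time reversal and antisymmetry make the mean drift its own negative, and make the sum of
  g(y) \<phi>(x,y) the negative of that of g(x) \<phi>(x,y). With f the drift, the cross terms of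
  the expanded square contribute -4 <g,f> and the Dirichlet part 2 <g,f>.\<close>

lemma
  assumes anti: "\<And>x y. \<phi> y x = - \<phi> x y"
  shows antisym_drift_mean: "inner_pi \<pi> 1 (drift \<phi>) = 0"
    and antisym_asymptotic_variance: "asymptotic_variance \<phi> =
      (\<Sum>x\<in>UNIV. \<Sum>y\<in>UNIV. \<pi> x * P $ x $ y * (\<phi> x y)\<^sup>2)
      - 2 * inner_pi \<pi> (inv_I_minus P \<pi> (drift \<phi>)) (drift \<phi>)"
proof -
  have "inner_pi \<pi> 1 (drift \<phi>) = - inner_pi \<pi> 1 (drift \<phi>)"
    unfolding inner_pi_drift by (subst flow_swap, subst anti) (simp add: sum_negf)
  then show mean: "inner_pi \<pi> 1 (drift \<phi>) = 0" by simp
  define g where "g = inv_I_minus P \<pi> (drift \<phi>)"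
  have x: "(\<Sum>x\<in>UNIV. \<Sum>y\<in>UNIV. \<pi> x * P $ x $ y * (g $ x * \<phi> x y)) = inner_pi \<pi> g (drift \<phi>)"
    by (simp add: inner_pi_drift)
  have y: "(\<Sum>x\<in>UNIV. \<Sum>y\<in>UNIV. \<pi> x * P $ x $ y * (g $ y * \<phi> x y)) = - inner_pi \<pi> g (drift \<phi>)"
    unfolding inner_pi_drift by (subst flow_swap, subst anti) (simp add: sum_negf)
  have d: "(\<Sum>x\<in>UNIV. \<Sum>y\<in>UNIV. \<pi> x * P $ x $ y * (g $ x - g $ y)\<^sup>2) = 2 * inner_pi \<pi> g (drift \<phi>)"
    using dirichlet_form[of g] inv_I_minus_props(1)[OF mean]
    by (simp add: inner_pi_commute[of \<pi> "drift \<phi>"] flip: g_def)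
  have "asymptotic_variance \<phi> =
      (\<Sum>x\<in>UNIV. \<Sum>y\<in>UNIV. \<pi> x * P $ x $ y * (\<phi> x y)\<^sup>2)
      + (\<Sum>x\<in>UNIV. \<Sum>y\<in>UNIV. \<pi> x * P $ x $ y * (g $ x - g $ y)\<^sup>2)
      + 2 * (\<Sum>x\<in>UNIV. \<Sum>y\<in>UNIV. \<pi> x * P $ x $ y * (g $ y * \<phi> x y))
      - 2 * (\<Sum>x\<in>UNIV. \<Sum>y\<in>UNIV. \<pi> x * P $ x $ y * (g $ x * \<phi> x y))"
    unfolding asymptotic_variance_def martingale_increment_def g_def[symmetric]
      sum_distrib_left sum.distrib[symmetric] sum_subtractf[symmetric]
    by (intro sum.cong refl) (simp add: power2_eq_square algebra_simps)
  then show "asymptotic_variance \<phi> =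
      (\<Sum>x\<in>UNIV. \<Sum>y\<in>UNIV. \<pi> x * P $ x $ y * (\<phi> x y)\<^sup>2)
      - 2 * inner_pi \<pi> (inv_I_minus P \<pi> (drift \<phi>)) (drift \<phi>)"
    unfolding x y d by (simp add: g_def)
qed

end

section \<open>Asymptotic moments of additive functionals of the reversible chain\<close>

locale reversible_markov_chain = reversible_chain P \<pi> + finite_markov_chain M X P
  for P :: "real^'v::finite^'v" and \<pi> :: "'v \<Rightarrow> real"
    and M :: "'w measure" and X :: "nat \<Rightarrow> 'w \<Rightarrow> 'v"
begin

lemma add_fun_martingale_decomposition:
  "add_fun \<phi> t x = add_fun (martingale_increment \<phi>) t x
    + (inv_I_minus P \<pi> (drift \<phi>) $ x 0 - inv_I_minus P \<pi> (drift \<phi>) $ x t)"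
  by (induction t) (simp_all add: add_fun_def martingale_increment_def)

lemma martingale_increment_centred:
  assumes "inner_pi \<pi> 1 (drift \<phi>) = 0"
  shows "(\<Sum>y\<in>UNIV. P $ x $ y * martingale_increment \<phi> x y) = 0"
proof -
  define g where "g = inv_I_minus P \<pi> (drift \<phi>)"
  have "(\<Sum>y\<in>UNIV. P $ x $ y * martingale_increment \<phi> x y) =
      drift \<phi> $ x + (P *v g) $ x - (\<Sum>y\<in>UNIV. P $ x $ y) * g $ x"
    unfolding martingale_increment_def g_def[symmetric]
    by (simp add: drift_def matrix_vector_mult_def algebra_simps
        sum.distrib sum_subtractf sum_distrib_left sum_distrib_right)
  also have "\<dots> = 0"
  proof -
    have "(g - P *v g) $ x = drift \<phi> $ x"
      using inv_I_minus_props(1)[OF assms] by (simp add: g_def)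
    then show ?thesis by (simp add: sum_P)
  qed
  finally show ?thesis .
qed

text \<open>The conditional variance V of an increment has stationary mean
  \<open>asymptotic_variance \<phi>\<close>. A second Poisson equation, for V minus this mean, has a
  bounded solution h, and only E[h(X_0)] - E[h(X_t)] remains as error.\<close>

lemma martingale_variance_bounded:
  assumes "inner_pi \<pi> 1 (drift \<phi>) = 0"
  obtains K where "\<And>t. \<bar>expectation (\<lambda>\<omega>. (add_fun (martingale_increment \<phi>) t (path \<omega>))\<^sup>2)
    - t * asymptotic_variance \<phi>\<bar> \<le> K"
proof -
  define d where "d = martingale_increment \<phi>"
  define V :: "real^'v" where "V = (\<chi> x. \<Sum>y\<in>UNIV. P $ x $ y * (d x y)\<^sup>2)"
  have "inner_pi \<pi> 1 V = asymptotic_variance \<phi>"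
    by (simp add: inner_pi_one V_def asymptotic_variance_def d_def sum_distrib_left mult_ac)
  then have "inner_pi \<pi> 1 (V - asymptotic_variance \<phi> *\<^sub>R 1) = 0"
    by (simp only: inner_pi_diff_right inner_pi_scaleR_right inner_pi_one(2))
  then obtain h where h: "h - P *v h = V - asymptotic_variance \<phi> *\<^sub>R 1"
    using poisson_solvable by blast
  have poisson: "(\<Sum>y\<in>UNIV. P $ x $ y * (d x y)\<^sup>2) =
      asymptotic_variance \<phi> + h $ x - (\<Sum>y\<in>UNIV. P $ x $ y * h $ y)" for x
  proof -
    have "(h - P *v h) $ x = (V - asymptotic_variance \<phi> *\<^sub>R 1) $ x" by (simp only: h)
    then show ?thesis by (simp add: V_def matrix_vector_mult_def)
  qed
  have mart: "(\<Sum>y\<in>UNIV. P $ x $ y * d x y) = 0" for x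
    unfolding d_def by (rule martingale_increment_centred[OF assms])
  obtain c where c: "\<And>x. \<bar>h $ x\<bar> \<le> c"
    using finite_fun_bounded[of "\<lambda>x. h $ x"] by metis
  have E: "\<bar>expectation (\<lambda>\<omega>. h $ X t \<omega>)\<bar> \<le> c" for t
  proof -
    have int: "integrable M (\<lambda>\<omega>. h $ X t \<omega>)"
      using integrable_path[of t "\<lambda>x. h $ x t"] by (simp add: depends_upto_def)
    have "\<bar>expectation (\<lambda>\<omega>. h $ X t \<omega>)\<bar> \<le> expectation (\<lambda>\<omega>. \<bar>h $ X t \<omega>\<bar>)"
      by (rule integral_abs_bound)
    also have "\<dots> \<le> c" using int c by (intro integral_le_const) auto
    finally show ?thesis .
  qed
  have "\<bar>expectation (\<lambda>\<omega>. (add_fun d t (path \<omega>))\<^sup>2) - t * asymptotic_variance \<phi>\<bar> \<le> 2 * c" for t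
    using martingale_variance[of d "asymptotic_variance \<phi>" "\<lambda>x. h $ x" t, OF mart poisson] E[of 0] E[of t]
    by linarith
  then show thesis unfolding d_def by (rule that)
qed

text \<open>The functional differs from its martingale part by a term bounded by r, so the
  martingale bound carries over; t >= 1 absorbs the constant in r into the multiple of t^2.\<close>

lemma add_fun_fourth_moment:
  assumes "inner_pi \<pi> 1 (drift \<phi>) = 0"
  obtains C where "\<And>t. t \<ge> 1 \<Longrightarrow> expectation (\<lambda>\<omega>. (add_fun \<phi> t (path \<omega>)) ^ 4) \<le> C * (real t)\<^sup>2"
proof -
  define d where "d = martingale_increment \<phi>"
  define g where "g = inv_I_minus P \<pi> (drift \<phi>)"
  have mart: "(\<Sum>y\<in>UNIV. P $ x $ y * d x y) = 0" for x
    unfolding d_def by (rule martingale_increment_centred[OF assms])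
  obtain c where "\<And>x. \<bar>case_prod d x\<bar> \<le> c"
    using finite_fun_bounded[of "case_prod d"] by metis
  then have c: "\<bar>d x y\<bar> \<le> c" for x y by (metis case_prod_conv)
  obtain r where r: "\<bar>g $ x - g $ y\<bar> \<le> r" for x y
    using finite_fun_bounded[of "\<lambda>(x, y). g $ x - g $ y"] by (metis case_prod_conv)
  \<comment> \<open>The inequality (p + q)^2 <= 2 p^2 + 2 q^2 is applied twice.\<close>
  have pow: "(s + a) ^ 4 \<le> 8 * s ^ 4 + 8 * r ^ 4" if "\<bar>a\<bar> \<le> r" for s a :: real
  proof -
    have sq: "(p + q)\<^sup>2 \<le> 2 * p\<^sup>2 + 2 * q\<^sup>2" for p q :: real
      using sum_squares_bound[of p q] by (simp add: power2_sum)
    have "((s + a)\<^sup>2)\<^sup>2 \<le> (2 * s\<^sup>2 + 2 * a\<^sup>2)\<^sup>2"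
      by (rule power_mono[OF sq]) simp
    also have "\<dots> \<le> 2 * (2 * s\<^sup>2)\<^sup>2 + 2 * (2 * a\<^sup>2)\<^sup>2" by (rule sq)
    also have "\<dots> = 8 * s ^ 4 + 8 * a ^ 4" by simp
    also have "a ^ 4 \<le> r ^ 4" using power_mono[OF that, of 4] by (simp add: power_even_abs)
    finally show ?thesis by simp
  qed
  have int: "integrable M (\<lambda>\<omega>. (add_fun \<phi> t (path \<omega>)) ^ 4)" for \<phi> t
    by (rule integrable_path[of t "\<lambda>x. (add_fun \<phi> t x) ^ 4"]) (intro depends_upto_intros; simp)
  have "expectation (\<lambda>\<omega>. (add_fun \<phi> t (path \<omega>)) ^ 4) \<le> (32 * c ^ 4 + 8 * r ^ 4) * (real t)\<^sup>2" if "t \<ge> 1" for t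
  proof -
    have "expectation (\<lambda>\<omega>. (add_fun \<phi> t (path \<omega>)) ^ 4) \<le>
        expectation (\<lambda>\<omega>. 8 * (add_fun d t (path \<omega>)) ^ 4 + 8 * r ^ 4)"
    proof (rule integral_mono)
      show "(add_fun \<phi> t (path \<omega>)) ^ 4 \<le> 8 * (add_fun d t (path \<omega>)) ^ 4 + 8 * r ^ 4" for \<omega>
        unfolding add_fun_martingale_decomposition[of \<phi>] d_def[symmetric] g_def[symmetric]
        by (rule pow[OF r])
    qed (use int in auto)
    also have "\<dots> = 8 * expectation (\<lambda>\<omega>. (add_fun d t (path \<omega>)) ^ 4) + 8 * r ^ 4"
      using int by (simp add: prob_space)
    also have "\<dots> \<le> 8 * (4 * c ^ 4 * (real t)\<^sup>2) + 8 * r ^ 4 * (real t)\<^sup>2"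
    proof (intro add_mono mult_left_mono martingale_fourth_moment_bound[of d, OF mart c])
      show "8 * r ^ 4 \<le> 8 * r ^ 4 * (real t)\<^sup>2"
        using that mult_left_mono[of 1 "(real t)\<^sup>2" "8 * r ^ 4"] by simp
    qed auto
    finally show ?thesis by (simp add: algebra_simps)
  qed
  then show thesis by (rule that)
qed

text \<open>Write the functional as S + R with S the martingale and R bounded. Then E[S^2] is t
  times the asymptotic variance up to O(1), while E[2 S R + R^2] is O(sqrt t); both errors vanish
  after division by t.\<close>

lemma add_fun_variance_limit:
  assumes "inner_pi \<pi> 1 (drift \<phi>) = 0"
  shows "(\<lambda>t. expectation (\<lambda>\<omega>. (add_fun \<phi> t (path \<omega>))\<^sup>2) / t) \<longlonglongrightarrow> asymptotic_variance \<phi>"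
proof -
  define d where "d = martingale_increment \<phi>"
  define g where "g = inv_I_minus P \<pi> (drift \<phi>)"
  define S where "S t \<omega> = add_fun d t (path \<omega>)" for t \<omega>
  define R where "R t \<omega> = g $ X 0 \<omega> - g $ X t \<omega>" for t \<omega>
  have mart: "(\<Sum>y\<in>UNIV. P $ x $ y * d x y) = 0" for x
    unfolding d_def by (rule martingale_increment_centred[OF assms])
  obtain K where K: "\<And>t. \<bar>expectation (\<lambda>\<omega>. (S t \<omega>)\<^sup>2) - t * asymptotic_variance \<phi>\<bar> \<le> K"
    using martingale_variance_bounded[OF assms] unfolding S_def d_def by metis
  obtain c where "\<And>x. \<bar>case_prod d x\<bar> \<le> c"
    using finite_fun_bounded[of "case_prod d"] by metis
  then have c: "\<bar>d x y\<bar> \<le> c" for x y by (metis case_prod_conv)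
  obtain r where r: "\<bar>g $ x - g $ y\<bar> \<le> r" for x y
    using finite_fun_bounded[of "\<lambda>(x, y). g $ x - g $ y"] by (metis case_prod_conv)
  have "r \<ge> 0" using r[of undefined undefined] by simp
  have int: "integrable M (\<lambda>\<omega>. (S t \<omega>)\<^sup>2)" "integrable M (\<lambda>\<omega>. \<bar>2 * S t \<omega> * R t \<omega> + (R t \<omega>)\<^sup>2\<bar>)"
      "integrable M (\<lambda>\<omega>. 2 * S t \<omega> * R t \<omega> + (R t \<omega>)\<^sup>2)" for t
    unfolding S_def R_def
    by (rule integrable_path[of t "\<lambda>x. (add_fun d t x)\<^sup>2"]
        integrable_path[of t "\<lambda>x. \<bar>2 * add_fun d t x * (g $ x 0 - g $ x t) + (g $ x 0 - g $ x t)\<^sup>2\<bar>"]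
        integrable_path[of t "\<lambda>x. 2 * add_fun d t x * (g $ x 0 - g $ x t) + (g $ x 0 - g $ x t)\<^sup>2"],
      intro depends_upto_intros; simp)+
  have dec: "expectation (\<lambda>\<omega>. (add_fun \<phi> t (path \<omega>))\<^sup>2) =
      expectation (\<lambda>\<omega>. (S t \<omega>)\<^sup>2) + expectation (\<lambda>\<omega>. 2 * S t \<omega> * R t \<omega> + (R t \<omega>)\<^sup>2)" for t
  proof -
    have "add_fun \<phi> t (path \<omega>) = S t \<omega> + R t \<omega>" for \<omega>
      by (simp add: add_fun_martingale_decomposition[of \<phi>] S_def R_def d_def g_def)
    then have "(add_fun \<phi> t (path \<omega>))\<^sup>2 = (S t \<omega>)\<^sup>2 + (2 * S t \<omega> * R t \<omega> + (R t \<omega>)\<^sup>2)" for \<omega>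
      by (simp add: power2_sum algebra_simps)
    then show ?thesis using int by simp
  qed
  have cross: "\<bar>expectation (\<lambda>\<omega>. 2 * S t \<omega> * R t \<omega> + (R t \<omega>)\<^sup>2)\<bar> \<le> r * (c\<^sup>2 + 1) * sqrt t + r\<^sup>2" if "t \<ge> 1" for t
  proof -
    have "\<bar>2 * S t \<omega> * R t \<omega> + (R t \<omega>)\<^sup>2\<bar> \<le> r * ((S t \<omega>)\<^sup>2 / sqrt t + sqrt t) + r\<^sup>2" for \<omega>
    proof -
      have Rr: "\<bar>R t \<omega>\<bar> \<le> r" using r by (simp add: R_def)
      have "\<bar>2 * S t \<omega> * R t \<omega> + (R t \<omega>)\<^sup>2\<bar> \<le> 2 * \<bar>S t \<omega>\<bar> * \<bar>R t \<omega>\<bar> + \<bar>R t \<omega>\<bar>\<^sup>2"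
        by (rule order_trans[OF abs_triangle_ineq]) (simp add: abs_mult)
      also have "\<dots> \<le> 2 * \<bar>S t \<omega>\<bar> * r + r\<^sup>2"
        using Rr by (intro add_mono mult_left_mono power_mono) auto
      also have "2 * \<bar>S t \<omega>\<bar> \<le> (S t \<omega>)\<^sup>2 / sqrt t + sqrt t"
        \<comment> \<open>AM-GM for \<open>S\<^sup>2 / \<surd>t\<close> and \<open>\<surd>t\<close>\<close>
      proof -
        have "0 \<le> (\<bar>S t \<omega>\<bar> - sqrt t)\<^sup>2 / sqrt t" by simp
        also have "\<dots> = ((S t \<omega>)\<^sup>2 + sqrt t * sqrt t - 2 * \<bar>S t \<omega>\<bar> * sqrt t) / sqrt t"
          by (simp add: power2_diff)
        also have "\<dots> = (S t \<omega>)\<^sup>2 / sqrt t + sqrt t - 2 * \<bar>S t \<omega>\<bar>"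
          using that by (simp add: add_divide_distrib diff_divide_distrib del: real_sqrt_mult_self)
        finally show ?thesis by simp
      qed
      finally show ?thesis using \<open>r \<ge> 0\<close> by (simp add: mult_right_mono mult.commute)
    qed
    note pointwise = this
    have "\<bar>expectation (\<lambda>\<omega>. 2 * S t \<omega> * R t \<omega> + (R t \<omega>)\<^sup>2)\<bar> \<le> expectation (\<lambda>\<omega>. \<bar>2 * S t \<omega> * R t \<omega> + (R t \<omega>)\<^sup>2\<bar>)"
      by (rule integral_abs_bound)
    also have "\<dots> \<le> expectation (\<lambda>\<omega>. r * ((S t \<omega>)\<^sup>2 / sqrt t + sqrt t) + r\<^sup>2)"
      using int by (intro integral_mono pointwise) auto
    also have "\<dots> = r * (expectation (\<lambda>\<omega>. (S t \<omega>)\<^sup>2) / sqrt t + sqrt t) + r\<^sup>2"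
      using int by (simp add: prob_space)
    also have "\<dots> \<le> r * (c\<^sup>2 * t / sqrt t + sqrt t) + r\<^sup>2"
      using \<open>r \<ge> 0\<close> martingale_second_moment_bound[of d c t, OF mart c]
      by (intro add_mono mult_left_mono divide_right_mono) (auto simp: S_def)
    also have "\<dots> = r * (c\<^sup>2 + 1) * sqrt t + r\<^sup>2"
    proof -
      have "c\<^sup>2 * t / sqrt t = c\<^sup>2 * sqrt t"
        by (simp only: times_divide_eq_right[symmetric] real_div_sqrt of_nat_0_le_iff)
      then show ?thesis by (simp add: algebra_simps)
    qed
    finally show ?thesis .
  qed
  have "(\<lambda>t. expectation (\<lambda>\<omega>. (add_fun \<phi> t (path \<omega>))\<^sup>2) / t - asymptotic_variance \<phi>) \<longlonglongrightarrow> 0"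
  proof (rule Lim_null_comparison)
    show "\<forall>\<^sub>F t::nat in sequentially.
        norm (expectation (\<lambda>\<omega>. (add_fun \<phi> t (path \<omega>))\<^sup>2) / t - asymptotic_variance \<phi>)
        \<le> K / t + r * (c\<^sup>2 + 1) / sqrt t + r\<^sup>2 / t"
    proof (rule eventually_sequentiallyI[of 1])
      fix t :: nat assume t: "1 \<le> t"
      have "expectation (\<lambda>\<omega>. (add_fun \<phi> t (path \<omega>))\<^sup>2) / t - asymptotic_variance \<phi> =
          (expectation (\<lambda>\<omega>. (add_fun \<phi> t (path \<omega>))\<^sup>2) - t * asymptotic_variance \<phi>) / t"
        using t by (simp add: field_simps)
      also have "norm \<dots> \<le> (K + r * (c\<^sup>2 + 1) * sqrt t + r\<^sup>2) / t"
        using K[of t] cross[OF t] unfolding dec real_norm_def abs_divide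
        by (simp add: divide_right_mono)
      also have "\<dots> = K / t + r * (c\<^sup>2 + 1) / sqrt t + r\<^sup>2 / t"
      proof -
        have "a * sqrt t / t = a / sqrt t" for a
          using t by (simp add: field_simps)
        then show ?thesis by (simp only: add_divide_distrib)
      qed
      finally show "norm (expectation (\<lambda>\<omega>. (add_fun \<phi> t (path \<omega>))\<^sup>2) / t - asymptotic_variance \<phi>)
        \<le> K / t + r * (c\<^sup>2 + 1) / sqrt t + r\<^sup>2 / t" .
    qed
    show "(\<lambda>t::nat. K / t + r * (c\<^sup>2 + 1) / sqrt t + r\<^sup>2 / t) \<longlonglongrightarrow> 0"
      by (intro tendsto_add_zero lim_const_over_n tendsto_divide_0[OF tendsto_const]
          filterlim_at_top_imp_at_infinity filterlim_compose[OF sqrt_at_top filterlim_real_sequentially])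
  qed
  then show ?thesis by (simp add: LIM_zero_iff)
qed

text \<open>Project onto u and test the convergence with min((u . z)^2, k), which is bounded and
  continuous on the whole space. The moment estimates then allow \<open>limit_variance\<close> to
  compare the variances.\<close>

lemma gaussian_limit_variance:
  fixes Z :: "nat \<Rightarrow> 'w \<Rightarrow> real^'g::finite" and \<phi> :: "real^'g \<Rightarrow> 'v \<Rightarrow> 'v \<Rightarrow> real"
  assumes Z: "\<And>u t \<omega>. u \<bullet> Z t \<omega> = add_fun (\<phi> u) t (path \<omega>) / sqrt t"
    and lim: "converges_to_gaussian M Z S"
    and mean: "inner_pi \<pi> 1 (drift (\<phi> u)) = 0"
  shows "u \<bullet> (S *v u) = asymptotic_variance (\<phi> u)"
proof -
  obtain N where N: "centered_gaussian S N" "converges_in_distribution (\<lambda>t. distr M borel (Z t)) N"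
    using lim by (auto simp: converges_to_gaussian_def)
  then interpret N: prob_space N by (simp add: centered_gaussian_def)
  have setsN [measurable_cong]: "sets N = sets borel" using N by (simp add: centered_gaussian_def)
  have int: "integrable M (\<lambda>\<omega>. (u \<bullet> Z t \<omega>) ^ n)" for u t n
    unfolding Z by (rule integrable_path[of t "\<lambda>x. (add_fun (\<phi> u) t x / sqrt t) ^ n"])
      (auto simp: depends_upto_def add_fun_def intro!: arg_cong[of _ _ "\<lambda>x. (x / sqrt t) ^ n"] sum.cong)
  have meas1: "(\<lambda>\<omega>. u \<bullet> Z t \<omega>) \<in> borel_measurable M" for u t
    using borel_measurable_integrable[OF int[of u t 1]] by simp
  \<comment> \<open>Coordinates are projections onto basis vectors, which is why \<open>Z\<close>
    describes all projections and not just the one onto the given u.\<close>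
  have meas [measurable]: "Z t \<in> borel_measurable M" for t
    using meas1 by (simp add: borel_measurable_euclidean_space[of "Z t"] inner_commute)
  obtain C where C: "\<And>t. t \<ge> 1 \<Longrightarrow> expectation (\<lambda>\<omega>. (add_fun (\<phi> u) t (path \<omega>)) ^ 4) \<le> C * (real t)\<^sup>2"
    using add_fun_fourth_moment[OF mean] by metis
  have "asymptotic_variance (\<phi> u) = u \<bullet> (S *v u)"
  proof (rule limit_variance[of M "\<lambda>t \<omega>. u \<bullet> Z t \<omega>"])
    show "prob_space M" by unfold_locales
    show "expectation (\<lambda>\<omega>. (u \<bullet> Z t \<omega>) ^ 4) \<le> C" if "t \<ge> 1" for t
    proof -
      have "sqrt t ^ 4 = ((sqrt t)\<^sup>2)\<^sup>2"
        by (simp only: power4_eq_xxxx power2_eq_square mult.assoc)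
      also have "\<dots> = (real t)\<^sup>2" by (simp only: real_sqrt_pow2 of_nat_0_le_iff)
      finally show ?thesis using C[OF that] that by (simp add: Z power_divide pos_divide_le_eq)
    qed
    show "(\<lambda>t. expectation (\<lambda>\<omega>. (u \<bullet> Z t \<omega>)\<^sup>2)) \<longlonglongrightarrow> asymptotic_variance (\<phi> u)"
      using add_fun_variance_limit[OF mean] by (simp add: Z power_divide)
    show "(\<lambda>t. expectation (\<lambda>\<omega>. min ((u \<bullet> Z t \<omega>)\<^sup>2) k)) \<longlonglongrightarrow>
        integral\<^sup>L (normal_dist (u \<bullet> (S *v u))) (\<lambda>x. min (x\<^sup>2) k)" if "k > 0" for k
    proof -
      define f where "f z = min ((u \<bullet> z)\<^sup>2) k" for z
      have cont: "continuous_on UNIV f" unfolding f_def by (intro continuous_intros)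
      have "\<bar>f z\<bar> \<le> k" for z using that by (simp add: f_def)
      then have "bounded (range f)" by (intro boundedI[of _ k]) auto
      with cont N(2) have "(\<lambda>t. integral\<^sup>L (distr M borel (Z t)) f) \<longlonglongrightarrow> integral\<^sup>L N f"
        by (simp add: converges_in_distribution_def)
      moreover have "f \<in> borel_measurable borel"
        using cont by (rule borel_measurable_continuous_onI)
      then have "integral\<^sup>L (distr M borel (Z t)) f = expectation (\<lambda>\<omega>. min ((u \<bullet> Z t \<omega>)\<^sup>2) k)" for t
        by (subst integral_distr) (simp_all add: f_def)
      moreover have "integral\<^sup>L N f = integral\<^sup>L (distr N borel (\<lambda>x. u \<bullet> x)) (\<lambda>x. min (x\<^sup>2) k)"
        unfolding f_def by (subst integral_distr) simp_all
      moreover have "distr N borel (\<lambda>x. u \<bullet> x) = normal_dist (u \<bullet> (S *v u))"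
        using N(1) by (simp add: centered_gaussian_def)
      ultimately show ?thesis by simp
    qed
    show "u \<bullet> (S *v u) \<ge> 0" using N(1) by (simp add: centered_gaussian_def)
  qed (simp_all add: int meas1)
  then show ?thesis ..
qed

end

section \<open>Homology coordinates\<close>

text \<open>The antisymmetric step function whose additive functional is the homology coordinate of
  the edge a.\<close>

definition crossing :: "'v \<times> 'v \<Rightarrow> 'v \<Rightarrow> 'v \<Rightarrow> real" where
  "crossing a x y = of_bool (x = fst a \<and> y = snd a) - of_bool (x = snd a \<and> y = fst a)"

lemma crossing_antisym: "crossing a y x = - crossing a x y"
  by (simp add: crossing_def conj_commute)

lemma homology_coord_eq_add_fun: "real_of_int (homology_coord a x t) = add_fun (crossing a) t x"
proof -
  have "real (card {s. s < t \<and> Q s}) = (\<Sum>s<t. of_bool (Q s))" for Q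
  proof -
    have "{s. s < t \<and> Q s} = {..<t} \<inter> {s. Q s}" by auto
    then show ?thesis by (simp only: sum_of_bool_eq finite_lessThan)
  qed
  then show ?thesis
    by (simp only: homology_coord_def add_fun_def crossing_def sum_subtractf of_int_diff
        of_int_of_nat_eq)
qed

text \<open>A nonzero crossing determines the unordered pair of endpoints, so one step cannot cross
  two different edges.\<close>

lemma crossing_mult_eq_0:
  assumes "{fst a, snd a} \<noteq> {fst b, snd b}"
  shows "crossing a x y * crossing b x y = 0"
proof -
  have "{fst c, snd c} = {x, y}" if "crossing c x y \<noteq> 0" for c
  proof -
    from that have "x = fst c \<and> y = snd c \<or> x = snd c \<and> y = fst c"
      by (auto simp: crossing_def)
    then show ?thesis by blast
  qed
  with assms show ?thesis by (metis mult_eq_0_iff)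
qed

context reversible_chain
begin

lemma drift_crossing: "fst a \<noteq> snd a \<Longrightarrow> drift (crossing a) = edge_fun P a"
proof -
  assume ne: "fst a \<noteq> snd a"
  have "(\<Sum>y\<in>UNIV. P $ x $ y * of_bool (x = p \<and> y = q)) = (if x = p then P $ p $ q else 0)" for x p q
    by (cases "x = p") (simp_all add: of_bool_def if_distrib cong: if_cong)
  then show ?thesis
    using ne by (simp add: drift_def edge_fun_def crossing_def vec_eq_iff right_diff_distrib sum_subtractf)
qed

lemma drift_add: "drift (\<lambda>x y. \<phi> x y + \<psi> x y) = drift \<phi> + drift \<psi>"
  by (simp add: drift_def vec_eq_iff distrib_left sum.distrib)

text \<open>The sum has the two terms \<pi>(x) P(x,y)^2 and \<pi>(y) P(y,x)^2; by detailed balance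
  both contain the factor \<pi>(x) P(x,y), which is the edge mass.\<close>

lemma edge_fun_norm:
  assumes "fst a \<noteq> snd a" and "stationary_dist (edge_states P) (edge_kernel P) \<pi>E"
  shows "inner_pi \<pi> (edge_fun P a) (edge_fun P a) = \<pi>E a * (P $ fst a $ snd a + P $ snd a $ fst a)"
proof -
  have "inner_pi \<pi> (edge_fun P a) (edge_fun P a) =
      (\<Sum>x\<in>{fst a, snd a}. \<pi> x * edge_fun P a $ x * edge_fun P a $ x)"
    unfolding inner_pi_def by (rule sum.mono_neutral_right) (auto simp: edge_fun_def)
  also have "\<dots> = \<pi> (fst a) * P $ fst a $ snd a * P $ fst a $ snd a + \<pi> (snd a) * P $ snd a $ fst a * P $ snd a $ fst a"
    using assms(1) by (simp add: edge_fun_def)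
  also have "\<dots> = \<pi> (fst a) * P $ fst a $ snd a * (P $ fst a $ snd a + P $ snd a $ fst a)"
    by (simp add: balance[of "snd a"] algebra_simps)
  also have "\<dots> = \<pi>E a * (P $ fst a $ snd a + P $ snd a $ fst a)"
  \<comment> \<open>On an edge without transitions the edge mass is not prescribed, but detailed
    balance makes the other factor 0.\<close>
  proof (cases "P $ fst a $ snd a = 0")
    case True
    then have "P $ snd a $ fst a = 0" using balance[of "fst a" "snd a"] \<pi>_pos[of "snd a"] by simp
    with True show ?thesis by simp
  next
    case False
    from edge_stationary[OF assms(2) this] show ?thesis by simp
  qed
  finally show ?thesis .
qed

end

section \<open>Polarization of the limiting covariance and its two-sided bounds\<close>

theorem mainTheorem8:
  fixes E T :: "'v::finite set set"
    and P :: "real^'v^'v"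
    and \<pi> :: "'v \<Rightarrow> real"
    and \<pi>\<^sub>E :: "'v \<times> 'v \<Rightarrow> real"
    and e :: "'g::{finite,linorder} \<Rightarrow> 'v \<times> 'v"
    and M :: "'w measure"
    and X :: "nat \<Rightarrow> 'w \<Rightarrow> 'v"
    and \<Sigma> :: "((real, 'g) vec, 'g) vec"
    and i j :: 'g
  assumes "simple_graph E" and "graph_connected E"
    and "stochastic P"
    and "\<And>x y. x \<noteq> y \<Longrightarrow> {x, y} \<notin> E \<Longrightarrow> P $ x $ y = 0"
    and "irreducible_chain P" and "aperiodic_chain P" and "lazy_chain P"
    and "stationary_dist UNIV (\<lambda>x y. P $ x $ y) \<pi>" and "reversible P \<pi>"
    and "markov_chain M X P"
    and "stationary_dist (edge_states P) (edge_kernel P) \<pi>\<^sub>E"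
    and "spanning_tree E T"
    and "bij_betw (\<lambda>k. {fst (e k), snd (e k)}) UNIV (E - T)"
    and "converges_to_gaussian M (scaled_homology e X) \<Sigma>"
    and "i < j"
  shows
    "let p = (\<lambda>k. P $ fst (e k) $ snd (e k) + P $ snd (e k) $ fst (e k));
         f = (\<lambda>k. edge_fun P (e k));
         \<delta> = spectral_gap P;
         \<gamma> = min_eigenvalue P
     in \<Sigma> $ i $ j = -2 * inner_pi \<pi> (inv_I_minus P \<pi> (f i)) (f j) \<and>
        \<Sigma> $ i $ j \<ge> (\<pi>\<^sub>E (e i) * p i + \<pi>\<^sub>E (e j) * p j) / (1 - \<gamma>)
                    - (norm_pi \<pi> (f i + f j))\<^sup>2 / \<delta> \<and>
        \<Sigma> $ i $ j \<le> (\<pi>\<^sub>E (e i) * p i + \<pi>\<^sub>E (e j) * p j) / \<delta>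
                    - (norm_pi \<pi> (f i + f j))\<^sup>2 / (1 - \<gamma>)"
proof -
  interpret reversible_markov_chain P \<pi> M X
    using assms by unfold_locales auto
  have ne: "fst (e k) \<noteq> snd (e k)" for k
  proof -
    have "{fst (e k), snd (e k)} \<in> E"
      using bij_betwE[OF assms(13)] by blast
    then have "card {fst (e k), snd (e k)} = 2"
      using assms(1) by (simp add: simple_graph_def)
    then show ?thesis by auto
  qed
  \<comment> \<open>The index type is inhabited, so at least one edge exists and supplies the two
    states that the spectral estimates require.\<close>
  then have ex: "\<exists>x y::'v. x \<noteq> y" by blast
  define f where "f k = edge_fun P (e k)" for k
  define A where "A = inv_I_minus P \<pi>"
  define Q where "Q \<psi> = (\<Sum>x\<in>UNIV. \<Sum>y\<in>UNIV. \<pi> x * P $ x $ y * (\<psi> x y)\<^sup>2)" for \<psi> :: "'v \<Rightarrow> 'v \<Rightarrow> real"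
  define \<phi> where "\<phi> u x y = (\<Sum>k\<in>UNIV. u $ k * crossing (e k) x y)" for u :: "(real, 'g) vec" and x y
  have \<phi>_anti: "\<phi> u y x = - \<phi> u x y" for u x y
    by (simp add: \<phi>_def crossing_antisym[of _ y x] sum_negf)
  have proj: "u \<bullet> scaled_homology e X t \<omega> = add_fun (\<phi> u) t (path \<omega>) / sqrt t" for u t \<omega>
  proof -
    have "add_fun (\<phi> u) t x = (\<Sum>k\<in>UNIV. u $ k * add_fun (crossing (e k)) t x)" for x
      unfolding add_fun_def \<phi>_def by (subst sum.swap) (simp add: sum_distrib_left)
    then show ?thesis
      by (simp add: inner_vec_def scaled_homology_def homology_coord_eq_add_fun sum_divide_distrib)
  qed
  have quad: "u \<bullet> (\<Sigma> *v u) = Q (\<phi> u) - 2 * inner_pi \<pi> (A (drift (\<phi> u))) (drift (\<phi> u))" for u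
    using gaussian_limit_variance[OF proj assms(14) antisym_drift_mean[OF \<phi>_anti]]
    by (simp add: antisym_asymptotic_variance[OF \<phi>_anti] Q_def A_def)
  have \<phi>_axis: "\<phi> (axis k 1) = crossing (e k)" for k
    by (simp add: fun_eq_iff \<phi>_def axis_def if_distrib[of "\<lambda>c. c * _"] cong: if_cong)
  have \<phi>_add: "\<phi> (u + v) = (\<lambda>x y. \<phi> u x y + \<phi> v x y)" for u v
    by (simp add: fun_eq_iff \<phi>_def algebra_simps sum.distrib)
  have drift_k: "drift (crossing (e k)) = f k" for k
    by (simp add: drift_crossing[OF ne] f_def)
  have mean: "inner_pi \<pi> 1 (f k) = 0" for k
    using antisym_drift_mean[of "crossing (e k)", OF crossing_antisym] by (simp add: drift_k)
  have "{fst (e i), snd (e i)} \<noteq> {fst (e j), snd (e j)}"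
    using bij_betw_imp_inj_on[OF assms(13)] \<open>i < j\<close> by (auto dest: injD)
  then have cross: "crossing (e i) x y * crossing (e j) x y = 0" for x y
    by (rule crossing_mult_eq_0)
  \<comment> \<open>The part \<open>Q\<close> of the variance is additive over the two edges, so it
    cancels under polarization and only the terms with (I - P)^(-1) survive.\<close>
  have Q_add: "Q (\<lambda>x y. crossing (e i) x y + crossing (e j) x y) = Q (crossing (e i)) + Q (crossing (e j))"
  proof -
    have "(crossing (e i) x y + crossing (e j) x y)\<^sup>2 = (crossing (e i) x y)\<^sup>2 + (crossing (e j) x y)\<^sup>2" for x y
      using cross[of x y] by (simp add: power2_sum)
    then show ?thesis
      by (simp only: Q_def distrib_left sum.distrib)
  qed
  have entry: "axis k 1 \<bullet> (\<Sigma> *v axis l 1) = \<Sigma> $ k $ l" for k l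
    by (simp add: inner_axis' matrix_vector_mult_basis column_def)
  have "transpose \<Sigma> = \<Sigma>"
    using assms(14) by (auto simp: converges_to_gaussian_def centered_gaussian_def)
  then have sym: "\<Sigma> $ j $ i = \<Sigma> $ i $ j"
    by (metis transpose_def vec_lambda_beta)
  have "(axis i 1 + axis j 1) \<bullet> (\<Sigma> *v (axis i 1 + axis j 1)) = \<Sigma> $ i $ i + \<Sigma> $ j $ j + 2 * \<Sigma> $ i $ j"
    by (simp add: matrix_vector_right_distrib inner_add_left inner_add_right entry sym)
  moreover have "(axis i 1 + axis j 1) \<bullet> (\<Sigma> *v (axis i 1 + axis j 1)) =
      Q (crossing (e i)) + Q (crossing (e j)) - 2 * inner_pi \<pi> (A (f i + f j)) (f i + f j)"
    by (simp add: quad \<phi>_add \<phi>_axis drift_add drift_k Q_add)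
  moreover have "\<Sigma> $ k $ k = Q (crossing (e k)) - 2 * inner_pi \<pi> (A (f k)) (f k)" for k
    unfolding entry[symmetric] by (simp add: quad \<phi>_axis drift_k)
  ultimately have polar: "\<Sigma> $ i $ j = inner_pi \<pi> (A (f i)) (f i) + inner_pi \<pi> (A (f j)) (f j)
      - inner_pi \<pi> (A (f i + f j)) (f i + f j)"
    by simp
  \<comment> \<open>Expanding the last term of \<open>polar\<close> bilinearly leaves minus the two
    mixed products, which coincide by self-adjointness.\<close>
  have "\<Sigma> $ i $ j = -2 * inner_pi \<pi> (A (f i)) (f j)"
    unfolding polar A_def
    by (simp add: inv_I_minus_add mean inner_pi_simps inv_I_minus_self_adjoint[of "f j" "f i"])
  moreover have sum_mean: "inner_pi \<pi> 1 (f i + f j) = 0" by (simp add: inner_pi_add_right mean)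
  have nrm: "inner_pi \<pi> (f k) (f k) = \<pi>\<^sub>E (e k) * (P $ fst (e k) $ snd (e k) + P $ snd (e k) $ fst (e k))" for k
    unfolding f_def by (rule edge_fun_norm[OF ne assms(11)])
  have nrm2: "(norm_pi \<pi> h)\<^sup>2 = inner_pi \<pi> h h" for h
    by (simp add: norm_pi_def inner_pi_nonneg)
  note bounds = inv_I_minus_upper[OF ex] inv_I_minus_lower[OF ex]
  \<comment> \<open>In \<open>polar\<close> the positive terms are bounded below through the
    smallest eigenvalue and the subtracted term above through the gap; the upper bound exchanges
    these roles.\<close>
  have "\<Sigma> $ i $ j \<ge> (inner_pi \<pi> (f i) (f i) + inner_pi \<pi> (f j) (f j)) / (1 - min_eigenvalue P)
      - (norm_pi \<pi> (f i + f j))\<^sup>2 / spectral_gap P"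
    using bounds(2)[OF mean[of i]] bounds(2)[OF mean[of j]] bounds(1)[OF sum_mean]
    unfolding polar nrm2 A_def add_divide_distrib by linarith
  moreover have "\<Sigma> $ i $ j \<le> (inner_pi \<pi> (f i) (f i) + inner_pi \<pi> (f j) (f j)) / spectral_gap P
      - (norm_pi \<pi> (f i + f j))\<^sup>2 / (1 - min_eigenvalue P)"
    using bounds(1)[OF mean[of i]] bounds(1)[OF mean[of j]] bounds(2)[OF sum_mean]
    unfolding polar nrm2 A_def add_divide_distrib by linarith
  ultimately show ?thesis
    unfolding Let_def nrm by (simp add: A_def f_def)
qed

end
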